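(* Let $D\ge 3$. For $r=0,1,\dots,D$ let $B'_r$ be an orthonormal basis of $\mathcal L'_r$ consisting of real vectors, let $N_r=\{r,r+1,\dots,D\}$, and let $\mathcal B'=\{(r,\xi,i):0\le r\le D,\ \xi\in B'_r,\ i\in N_r\}$. For $(r,\xi,i)\in\mathcal B'$ define $u_{r,\xi,i}=\binom{2D+1-2r}{i-r}^{-1/2}M^r_{i,r}\xi$, and let $U'$ be the $X\times\mathcal B'$ matrix whose $(r,\xi,i)$-column is $u_{r,\xi,i}$. Then $U'$ gives a block-diagonalization of the Terwilliger algebra $T$ of $\square_{2D+1}$: the columns of $U'$ form an orthonormal basis of $\mathbb C^X$, and for every $M\in T$ the entry of $U'^{\mathrm T}MU'$ in position $((r,\xi,i),(r',\xi',j))$ vanishes unless $(r,\xi)=(r',\xi')$, each block (rows and columns indexed by $N_r$) depending only on $r$. Moreover $T$ is isomorphic to $\bigoplus_{r=0}^{D}\mathbb C^{N_r\times N_r}$.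
   Context: Let $S=\{1,\dots,2D+1\}$, $X$ the set of unordered pairs $\{u,u'\}$ of subsets of $S$ with $u\cap u'=\emptyset$, $u\cup u'=S$. The folded cube $\square_{2D+1}$ is the graph on $X$ with distance $\partial(x,y)=\min\{|x_1\triangle y_1|,|x_1\triangle y_2|\}$ for $x=\{x_1,x_2\},y=\{y_1,y_2\}$ (adjacent iff distance $1$); its diameter is $D$. Let $\mathbf 0=\{\emptyset,S\}$. Write each vertex as $x=(x_1,x_2)$ with $|x_1|<|x_2|$. For $0\le t\le i,j\le D$ with $i+j-t\le 2D$, $M^t_{i,j}$ is the $X\times X$ matrix with $(x,y)$-entry $1$ if $|x_1|=i$, $|y_1|=j$, $|x_1\cap y_1|=t$, and $0$ otherwise. For $0\le r\le D$, $\mathcal L'_r=\{\xi\in\mathbb C^X:\xi_x=0\text{ whenever }|x_1|\ne r,\ M^{r-1}_{r-1,r}\xi=0\}$ (for $r=0$ the second condition is void). $A_k$ is the distance-$k$ matrix, $E^*_k$ the diagonal matrix with $(y,y)$-entry $1$ iff $\partial(\mathbf 0,y)=k$, and the Terwilliger algebra $T$ (with respect to $\mathbf 0$) is the subalgebra of $\mathrm{Mat}_X(\mathbb C)$ generated by $A_0,\dots,A_D,E^*_0,\dots,E^*_D$. *)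

theory Defs
  imports Complex_Main "HOL-Library.Function_Algebras" "HOL-Library.FuncSet"
    "HOL-Algebra.Module" "HOL-Algebra.QuotRing"
begin

section \<open>Vectors and matrices over finite index sets\<close>

text \<open>
  Vectors in $\mathbb{C}^I$ and $I \times J$ matrices are functions that vanish outside the
  index set(s), so that equality of vectors and matrices is equality of functions.
\<close>

definition vecs :: "'i set \<Rightarrow> ('i \<Rightarrow> complex) set" where
  "vecs I = {v. \<forall>i. i \<notin> I \<longrightarrow> v i = 0}"

definition mats :: "'i set \<Rightarrow> 'j set \<Rightarrow> ('i \<Rightarrow> 'j \<Rightarrow> complex) set" where
  "mats I J = {A. \<forall>i j. \<not> (i \<in> I \<and> j \<in> J) \<longrightarrow> A i j = 0}"

definition mat_mult ::
  "'j set \<Rightarrow> ('i \<Rightarrow> 'j \<Rightarrow> complex) \<Rightarrow> ('j \<Rightarrow> 'k \<Rightarrow> complex) \<Rightarrow> 'i \<Rightarrow> 'k \<Rightarrow> complex" where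
  "mat_mult J A B = (\<lambda>i k. \<Sum>j\<in>J. A i j * B j k)"

definition mat_vec ::
  "'j set \<Rightarrow> ('i \<Rightarrow> 'j \<Rightarrow> complex) \<Rightarrow> ('j \<Rightarrow> complex) \<Rightarrow> 'i \<Rightarrow> complex" where
  "mat_vec J A v = (\<lambda>i. \<Sum>j\<in>J. A i j * v j)"

definition mat_transpose :: "('i \<Rightarrow> 'j \<Rightarrow> complex) \<Rightarrow> 'j \<Rightarrow> 'i \<Rightarrow> complex" where
  "mat_transpose A = (\<lambda>j i. A i j)"

definition inner_vec :: "'i set \<Rightarrow> ('i \<Rightarrow> complex) \<Rightarrow> ('i \<Rightarrow> complex) \<Rightarrow> complex" where
  "inner_vec I v w = (\<Sum>i\<in>I. v i * cnj (w i))"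

global_interpretation cvec: vector_space "\<lambda>(c::complex) (v::'i \<Rightarrow> complex) i. c * v i"
  by standard (auto simp: fun_eq_iff algebra_simps)

text \<open>The family \<open>v\<close>, indexed by \<open>K\<close>, is an orthonormal basis of the subspace \<open>V\<close> of $\mathbb{C}^I$.\<close>

definition orthonormal_basis ::
  "'i set \<Rightarrow> ('i \<Rightarrow> complex) set \<Rightarrow> 'k set \<Rightarrow> ('k \<Rightarrow> 'i \<Rightarrow> complex) \<Rightarrow> bool" where
  "orthonormal_basis I V K v \<longleftrightarrow>
     (\<forall>a\<in>K. v a \<in> V) \<and>
     (\<forall>a\<in>K. \<forall>b\<in>K. inner_vec I (v a) (v b) = (if a = b then 1 else 0)) \<and>
     cvec.span (v ` K) = V"

section \<open>Complex algebras\<close>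

definition mat_alg :: "'i set \<Rightarrow> (complex, 'i \<Rightarrow> 'i \<Rightarrow> complex) module" where
  "mat_alg I = \<lparr>carrier = mats I I,
     monoid.mult = mat_mult I,
     one = (\<lambda>i j. if i \<in> I \<and> i = j then 1 else 0),
     zero = (\<lambda>i j. 0),
     add = (\<lambda>A B i j. A i j + B i j),
     smult = (\<lambda>c A i j. c * A i j)\<rparr>"

definition direct_sum_alg ::
  "'r set \<Rightarrow> ('r \<Rightarrow> (complex, 'm) module) \<Rightarrow> (complex, 'r \<Rightarrow> 'm) module" where
  "direct_sum_alg R A = \<lparr>carrier = (\<Pi>\<^sub>E r\<in>R. carrier (A r)),
     monoid.mult = (\<lambda>f g. \<lambda>r\<in>R. f r \<otimes>\<^bsub>A r\<^esub> g r),
     one = (\<lambda>r\<in>R. \<one>\<^bsub>A r\<^esub>),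
     zero = (\<lambda>r\<in>R. \<zero>\<^bsub>A r\<^esub>),
     add = (\<lambda>f g. \<lambda>r\<in>R. f r \<oplus>\<^bsub>A r\<^esub> g r),
     smult = (\<lambda>c f. \<lambda>r\<in>R. c \<odot>\<^bsub>A r\<^esub> f r)\<rparr>"

inductive_set generated_subalgebra :: "(complex, 'm) module \<Rightarrow> 'm set \<Rightarrow> 'm set"
  for A :: "(complex, 'm) module" and G :: "'m set" where
  gen: "a \<in> G \<Longrightarrow> a \<in> generated_subalgebra A G"
| one: "\<one>\<^bsub>A\<^esub> \<in> generated_subalgebra A G"
| add: "\<lbrakk>a \<in> generated_subalgebra A G; b \<in> generated_subalgebra A G\<rbrakk>
         \<Longrightarrow> a \<oplus>\<^bsub>A\<^esub> b \<in> generated_subalgebra A G"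
| mult: "\<lbrakk>a \<in> generated_subalgebra A G; b \<in> generated_subalgebra A G\<rbrakk>
         \<Longrightarrow> a \<otimes>\<^bsub>A\<^esub> b \<in> generated_subalgebra A G"
| smult: "a \<in> generated_subalgebra A G \<Longrightarrow> c \<odot>\<^bsub>A\<^esub> a \<in> generated_subalgebra A G"

definition alg_isomorphic :: "(complex, 'm) module \<Rightarrow> (complex, 'n) module \<Rightarrow> bool" where
  "alg_isomorphic A B \<longleftrightarrow>
     (\<exists>h \<in> ring_iso A B. \<forall>c. \<forall>a\<in>carrier A. h (c \<odot>\<^bsub>A\<^esub> a) = c \<odot>\<^bsub>B\<^esub> h a)"

section \<open>The folded cube of odd order\<close>

type_synonym fc_vertex = "nat set set"

definition fc_ground :: "nat \<Rightarrow> nat set" where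
  "fc_ground D = {1..2*D+1}"

definition fc_verts :: "nat \<Rightarrow> fc_vertex set" where
  "fc_verts D = {{u, u'} | u u'. u \<inter> u' = {} \<and> u \<union> u' = fc_ground D}"

text \<open>The components of a vertex $x = (x_1, x_2)$, written with $|x_1| < |x_2|$.\<close>

definition part1 :: "fc_vertex \<Rightarrow> nat set" where
  "part1 x = (THE u. \<exists>u'. x = {u, u'} \<and> card u < card u')"

definition part2 :: "fc_vertex \<Rightarrow> nat set" where
  "part2 x = (THE u'. \<exists>u. x = {u, u'} \<and> card u < card u')"

text \<open>
  The value does not depend on how the components of the two vertices are labelled,
  see \<open>fc_dist_labelling\<close> below.
\<close>

definition fc_dist :: "fc_vertex \<Rightarrow> fc_vertex \<Rightarrow> nat" where
  "fc_dist x y = min (card (sym_diff (part1 x) (part1 y))) (card (sym_diff (part1 x) (part2 y)))"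

definition fc_zero :: "nat \<Rightarrow> fc_vertex" where
  "fc_zero D = {{}, fc_ground D}"

definition fc_A :: "nat \<Rightarrow> nat \<Rightarrow> fc_vertex \<Rightarrow> fc_vertex \<Rightarrow> complex" where
  "fc_A D k = (\<lambda>x y. if x \<in> fc_verts D \<and> y \<in> fc_verts D \<and> fc_dist x y = k then 1 else 0)"

definition fc_Estar :: "nat \<Rightarrow> nat \<Rightarrow> fc_vertex \<Rightarrow> fc_vertex \<Rightarrow> complex" where
  "fc_Estar D k = (\<lambda>x y. if x \<in> fc_verts D \<and> x = y \<and> fc_dist (fc_zero D) y = k then 1 else 0)"

definition terwilliger :: "nat \<Rightarrow> (fc_vertex \<Rightarrow> fc_vertex \<Rightarrow> complex) set" where
  "terwilliger D =
     generated_subalgebra (mat_alg (fc_verts D)) (fc_A D ` {0..D} \<union> fc_Estar D ` {0..D})"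

definition terwilliger_alg :: "nat \<Rightarrow> (complex, fc_vertex \<Rightarrow> fc_vertex \<Rightarrow> complex) module" where
  "terwilliger_alg D = (mat_alg (fc_verts D))\<lparr>carrier := terwilliger D\<rparr>"

text \<open>\<open>fc_M D t i j\<close> is $M^t_{i,j}$.\<close>

definition fc_M :: "nat \<Rightarrow> nat \<Rightarrow> nat \<Rightarrow> nat \<Rightarrow> fc_vertex \<Rightarrow> fc_vertex \<Rightarrow> complex" where
  "fc_M D t i j = (\<lambda>x y. if x \<in> fc_verts D \<and> y \<in> fc_verts D \<and>
      card (part1 x) = i \<and> card (part1 y) = j \<and> card (part1 x \<inter> part1 y) = t then 1 else 0)"

definition fc_L :: "nat \<Rightarrow> nat \<Rightarrow> (fc_vertex \<Rightarrow> complex) set" where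
  "fc_L D r = {\<xi> \<in> vecs (fc_verts D).
     (\<forall>x\<in>fc_verts D. card (part1 x) \<noteq> r \<longrightarrow> \<xi> x = 0) \<and>
     (r \<noteq> 0 \<longrightarrow> mat_vec (fc_verts D) (fc_M D (r - 1) (r - 1) r) \<xi> = (\<lambda>x. 0))}"

definition fc_u :: "nat \<Rightarrow> nat \<Rightarrow> (fc_vertex \<Rightarrow> complex) \<Rightarrow> nat \<Rightarrow> fc_vertex \<Rightarrow> complex" where
  "fc_u D r \<xi> i = (\<lambda>x. complex_of_real (1 / sqrt (real ((2*D + 1 - 2*r) choose (i - r))))
                      * mat_vec (fc_verts D) (fc_M D r i r) \<xi> x)"

definition fc_N :: "nat \<Rightarrow> nat \<Rightarrow> nat set" where
  "fc_N D r = {r..D}"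

definition fc_index ::
  "nat \<Rightarrow> (nat \<Rightarrow> (fc_vertex \<Rightarrow> complex) set) \<Rightarrow> (nat \<times> (fc_vertex \<Rightarrow> complex) \<times> nat) set" where
  "fc_index D B = {(r, \<xi>, i). r \<le> D \<and> \<xi> \<in> B r \<and> i \<in> fc_N D r}"

definition fc_U ::
  "nat \<Rightarrow> (nat \<Rightarrow> (fc_vertex \<Rightarrow> complex) set)
     \<Rightarrow> fc_vertex \<Rightarrow> nat \<times> (fc_vertex \<Rightarrow> complex) \<times> nat \<Rightarrow> complex" where
  "fc_U D B = (\<lambda>x b. if b \<in> fc_index D B then (case b of (r, \<xi>, i) \<Rightarrow> fc_u D r \<xi> i x) else 0)"

lemma part_eqs:
  assumes "card u < card u'"
  shows "part1 {u, u'} = u" and "part2 {u, u'} = u'"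
  using assms unfolding part1_def part2_def
  by (auto intro!: the_equality simp: doubleton_eq_iff)

lemma complementary_card_neq:
  assumes "u \<inter> u' = {}" "u \<union> u' = fc_ground D"
  shows "card u \<noteq> card u'"
proof
  assume eq: "card u = card u'"
  have "finite (u \<union> u')" using assms by (simp add: fc_ground_def)
  then have "card (u \<union> u') = card u + card u'"
    using assms(1) by (intro card_Un_disjoint) auto
  then have "2 * D + 1 = 2 * card u" using assms(2) eq by (simp add: fc_ground_def)
  then show False by presburger
qed

lemma fc_dist_labelling:
  assumes x: "x1 \<inter> x2 = {}" "x1 \<union> x2 = fc_ground D"
    and y: "y1 \<inter> y2 = {}" "y1 \<union> y2 = fc_ground D"
  shows "fc_dist {x1, x2} {y1, y2} = min (card (sym_diff x1 y1)) (card (sym_diff x1 y2))"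
proof -
  have s: "sym_diff x2 y2 = sym_diff x1 y1" "sym_diff x2 y1 = sym_diff x1 y2"
    using x y by blast+
  have px: "part1 {x1, x2} = x1 \<or> part1 {x1, x2} = x2"
    using complementary_card_neq[OF x] part_eqs[of x1 x2] part_eqs[of x2 x1]
    by (metis insert_commute linorder_neqE_nat)
  have py: "part1 {y1, y2} = y1 \<and> part2 {y1, y2} = y2 \<or> part1 {y1, y2} = y2 \<and> part2 {y1, y2} = y1"
    using complementary_card_neq[OF y] part_eqs[of y1 y2] part_eqs[of y2 y1]
    by (metis insert_commute linorder_neqE_nat)
  show ?thesis
    using px py s unfolding fc_dist_def by (auto simp: min.commute)
qed

end

theory Submission
  imports Defs "HOL-Combinatorics.Transposition"
begin

text \<open>
  Identify a vertex $x$ with the set $x_1$, put $n = 2D+1$ and let $\xi \in \mathcal{L}'_r$. Double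
  counting the relation $M^{r-1}_{r-1,r}\xi = 0$ shows that the sum of $\xi$ over the $r$-sets meeting
  a given set $x$ in $q$ points is $(-1)^{r-q}\binom{r}{q}$ times its sum over the $r$-subsets
  of $x$. Hence $M^t_{i,j} M^r_{j,r}\xi$ is a multiple of $M^r_{i,r}\xi$ by a factor that does not depend
  on $\xi$. All else follows from this. The factor of $M^r_{r,j}M^r_{j,r}$ on $\mathcal{L}'_r$ is an
  iterated difference of binomial coefficients, equal to $\binom{n-2r}{j-r}$, which gives orthonormality.
  A vector on level $i$ orthogonal to all $M^r_{i,r}\xi$ is killed by $M^{i-1}_{i-1,i}$, by induction on
  $i$, so it lies in $\mathcal{L}'_i$ and vanishes. Finally $M^r_{i,r} M^r_{r,j} \in T$ acts as zero on the
  blocks beyond $r$ and as a nonzero multiple of a matrix unit on block $r$, so that by induction on $r$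
  all matrix units of all blocks come from $T$.
\<close>

section \<open>Vertices as subsets of size at most $D$\<close>

text \<open>No dimension is computed. The generators have entries depending only on |x1|, |y1| and
  |x1 \<inter> y1|, so every element of T acts on the vectors u of index r by one matrix that is the
  same for all \<xi> (\<open>block_action\<close>). Sending M to its family of matrices is injective
  because the u have trivial orthogonal complement, and surjective because every matrix unit lies in
  T. The obstacle to the matrix units is the folding: distance k between two vertices can come from
  a symmetric difference of size k or of size 2D+1-k. In E*_i A_k E*_j with k = |i-j| the second
  source is excluded by parity, which leaves exactly M^t_{i,j} with t = min(i,j). These are the only
  M^t_{i,j} that are shown to lie in T, and they suffice for the products in the last step. All
  statements about L'_r concern arbitrary vectors in it; the bases B'_r enter only in the final
  theorem. An explicit nonzero vector in L'_r is also required: if L'_r were zero, block r would not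
  be visible in T at all.\<close>

lemma finite_fc_ground [simp]: "finite (fc_ground D)"
  and card_fc_ground [simp]: "card (fc_ground D) = 2 * D + 1"
  by (simp_all add: fc_ground_def)

lemma fc_verts_cases:
  assumes "x \<in> fc_verts D"
  obtains u where "u \<subseteq> fc_ground D" "card u \<le> D" "x = {u, fc_ground D - u}"
    "part1 x = u" "part2 x = fc_ground D - u"
proof -
  note outer = that
  obtain u u' where x: "x = {u, u'}" "u \<inter> u' = {}" "u \<union> u' = fc_ground D"
    using assms unfolding fc_verts_def by blast
  have main: thesis if "x = {v, v'}" "v \<inter> v' = {}" "v \<union> v' = fc_ground D" "card v < card v'" for v v'
  proof -
    have "v' = fc_ground D - v" using that by blast
    moreover have "v \<subseteq> fc_ground D" using that by blast
    moreover have "card v \<le> D"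
    proof -
      have "finite v" "finite v'" using that(3) finite_fc_ground[of D] by (metis finite_Un)+
      then have "card v + card v' = 2 * D + 1"
        using card_Un_disjoint[of v v'] that(2,3) by simp
      then show ?thesis using that(4) by simp
    qed
    ultimately show thesis using that(1) part_eqs[OF that(4)] outer by blast
  qed
  show thesis
  proof (cases "card u < card u'")
    case True
    then show thesis using main[OF x] by blast
  next
    case False
    then have "card u' < card u" using complementary_card_neq[OF x(2,3)] by simp
    then show thesis using main[of u' u] x by (auto simp: insert_commute Un_commute Int_commute)
  qed
qed

lemma fc_verts_intro:
  assumes "u \<subseteq> fc_ground D" "card u \<le> D"
  shows "{u, fc_ground D - u} \<in> fc_verts D" "part1 {u, fc_ground D - u} = u"
proof -
  show "{u, fc_ground D - u} \<in> fc_verts D"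
    using assms(1) unfolding fc_verts_def by blast
  have "card (fc_ground D - u) = 2 * D + 1 - card u"
    using assms(1) by (simp add: card_Diff_subset finite_subset[OF assms(1)])
  then show "part1 {u, fc_ground D - u} = u"
    using assms(2) by (intro part_eqs) simp
qed

lemma bij_betw_part1: "bij_betw part1 (fc_verts D) {u. u \<subseteq> fc_ground D \<and> card u \<le> D}"
proof (rule bij_betw_imageI)
  show "inj_on part1 (fc_verts D)"
    by (rule inj_onI) (auto elim!: fc_verts_cases)
  show "part1 ` fc_verts D = {u. u \<subseteq> fc_ground D \<and> card u \<le> D}"
  proof (intro equalityI subsetI)
    fix u assume "u \<in> part1 ` fc_verts D"
    then obtain x where "x \<in> fc_verts D" "u = part1 x" by blast
    then show "u \<in> {u. u \<subseteq> fc_ground D \<and> card u \<le> D}"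
      by (auto elim!: fc_verts_cases)
  next
    fix u assume "u \<in> {u. u \<subseteq> fc_ground D \<and> card u \<le> D}"
    then show "u \<in> part1 ` fc_verts D"
      using fc_verts_intro[of u D] by (intro image_eqI[where x = "{u, fc_ground D - u}"]) auto
  qed
qed

lemma part1_props:
  assumes "x \<in> fc_verts D"
  shows "part1 x \<subseteq> fc_ground D" "card (part1 x) \<le> D" "finite (part1 x)"
    "part2 x = fc_ground D - part1 x"
  by (rule fc_verts_cases[OF assms]; simp add: finite_subset[OF _ finite_fc_ground])+

lemma part1_eq_iff: "x \<in> fc_verts D \<Longrightarrow> y \<in> fc_verts D \<Longrightarrow> part1 x = part1 y \<longleftrightarrow> x = y"
  using bij_betw_part1[of D] unfolding bij_betw_def inj_on_def by blast

lemma finite_fc_verts [simp]: "finite (fc_verts D)"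
proof -
  have "finite {u. u \<subseteq> fc_ground D \<and> card u \<le> D}"
    by (rule finite_subset[of _ "Pow (fc_ground D)"]) auto
  then show ?thesis using bij_betw_finite[OF bij_betw_part1] by blast
qed

lemma card_fc_verts_part1:
  assumes "\<And>u. P u \<Longrightarrow> u \<subseteq> fc_ground D \<and> card u \<le> D"
  shows "card {x \<in> fc_verts D. P (part1 x)} = card {u. P u}"
proof (rule bij_betw_same_card)
  show "bij_betw part1 {x \<in> fc_verts D. P (part1 x)} {u. P u}"
    unfolding bij_betw_def
  proof (intro conjI)
    show "inj_on part1 {x \<in> fc_verts D. P (part1 x)}"
      using bij_betw_part1[of D] by (auto simp: bij_betw_def inj_on_def)
    show "part1 ` {x \<in> fc_verts D. P (part1 x)} = {u. P u}"
    proof (intro equalityI subsetI)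
      fix u assume "u \<in> {u. P u}"
      then show "u \<in> part1 ` {x \<in> fc_verts D. P (part1 x)}"
        using fc_verts_intro[of u D] assms[of u]
        by (intro image_eqI[where x = "{u, fc_ground D - u}"]) auto
    qed auto
  qed
qed

section \<open>The folded distance through intersection sizes\<close>

lemma card_sym_diff_plus:
  assumes "finite a" "finite b"
  shows "card (sym_diff a b) + 2 * card (a \<inter> b) = card a + card b"
proof -
  have "card a = card (a - b) + card (a \<inter> b)"
    using card_Int_Diff[OF assms(1), of b] by simp
  moreover have "card b = card (b - a) + card (a \<inter> b)"
    using card_Int_Diff[OF assms(2), of a] by (simp add: Int_commute)
  moreover have "card (sym_diff a b) = card (a - b) + card (b - a)"
    using assms by (intro card_Un_disjoint) auto
  ultimately show ?thesis by simp
qed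

lemma fc_dist_eq:
  assumes "x \<in> fc_verts D" "y \<in> fc_verts D"
  shows "fc_dist x y = min (card (sym_diff (part1 x) (part1 y)))
                           (2 * D + 1 - card (sym_diff (part1 x) (part1 y)))"
proof -
  note p = part1_props[OF assms(1)] part1_props[OF assms(2)]
  have "sym_diff (part1 x) (part2 y) = fc_ground D - sym_diff (part1 x) (part1 y)"
    using p by blast
  moreover have "card \<dots> = 2 * D + 1 - card (sym_diff (part1 x) (part1 y))"
    using p by (subst card_Diff_subset) auto
  ultimately show ?thesis unfolding fc_dist_def by simp
qed

lemma fc_zero: "fc_zero D \<in> fc_verts D" "part1 (fc_zero D) = {}"
  using fc_verts_intro[of "{}" D] unfolding fc_zero_def by simp_all

lemma fc_dist_zero:
  assumes "y \<in> fc_verts D"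
  shows "fc_dist (fc_zero D) y = card (part1 y)"
  using fc_dist_eq[OF fc_zero(1) assms] part1_props[OF assms] by (simp add: fc_zero)

section \<open>Counting subsets\<close>

text \<open>The size is prescribed additively because truncated subtraction would turn an impossible
  size t - q with t < q into 0, and the empty set would then be counted.\<close>

lemma card_subsets_offset:
  assumes "finite A"
  shows "card {a. a \<subseteq> A \<and> card a + q = t} = (if q \<le> t then card A choose (t - q) else 0)"
proof (cases "q \<le> t")
  case True
  then have "{a. a \<subseteq> A \<and> card a + q = t} = {a. a \<subseteq> A \<and> card a = t - q}" by auto
  then show ?thesis using True assms by (simp add: n_subsets)
next
  case False
  then have "{a. a \<subseteq> A \<and> card a + q = t} = {}" by auto
  then show ?thesis using False by (simp only: card.empty) simp
qed

text \<open>Since w contains y, it is determined by its part in x - y and its part outside x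
  \<union> y. Meeting x in t points fixes the size of the first part, and the total size j then
  fixes that of the second, so the two choices are independent.\<close>

lemma card_supersets_meeting:
  assumes "finite S" "x \<subseteq> S" "y \<subseteq> S"
  shows "card {w. w \<subseteq> S \<and> card w = j \<and> card (x \<inter> w) = t \<and> y \<subseteq> w} =
    card {a. a \<subseteq> x - y \<and> card a + card (x \<inter> y) = t} *
    card {b. b \<subseteq> S - x - y \<and> card b + (card (y - x) + t) = j}" (is "card ?W = card ?A * card ?B")
proof -
  have fin: "finite w" if "w \<subseteq> S" for w using that assms(1) finite_subset by blast
  have split: "card (x \<inter> w) = card (x \<inter> w - y) + card (x \<inter> y)"
       "card w = card (w - x - y) + (card (y - x) + card (x \<inter> w))"
    if w: "w \<subseteq> S" "y \<subseteq> w" for w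
  proof -
    have f: "finite w" "finite x" "finite y" using fin w assms by auto
    have "x \<inter> w \<inter> y = x \<inter> y" using w by blast
    then show "card (x \<inter> w) = card (x \<inter> w - y) + card (x \<inter> y)"
      using card_Int_Diff[of "x \<inter> w" y] f by simp
    have "w = (w - x - y) \<union> ((y - x) \<union> (x \<inter> w))" using w by blast
    moreover have "card \<dots> = card (w - x - y) + card ((y - x) \<union> (x \<inter> w))"
      using f by (intro card_Un_disjoint) auto
    moreover have "card ((y - x) \<union> (x \<inter> w)) = card (y - x) + card (x \<inter> w)"
      using f by (intro card_Un_disjoint) auto
    ultimately show "card w = card (w - x - y) + (card (y - x) + card (x \<inter> w))" by simp
  qed
  have "bij_betw (\<lambda>w. (x \<inter> w - y, w - x - y)) ?W (?A \<times> ?B)"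
  proof (rule bij_betw_byWitness[where f' = "\<lambda>(a, b). y \<union> a \<union> b"])
    show "(\<lambda>w. (x \<inter> w - y, w - x - y)) ` ?W \<subseteq> ?A \<times> ?B"
    proof (rule image_subsetI)
      fix w assume w: "w \<in> ?W"
      then have "w \<subseteq> S" "y \<subseteq> w" by auto
      note split[OF this]
      then show "(x \<inter> w - y, w - x - y) \<in> ?A \<times> ?B"
        using w by (simp add: Diff_mono)
    qed
    show "(\<lambda>(a, b). y \<union> a \<union> b) ` (?A \<times> ?B) \<subseteq> ?W"
    proof
      fix w assume "w \<in> (\<lambda>(a, b). y \<union> a \<union> b) ` (?A \<times> ?B)"
      then obtain a b where ab: "w = y \<union> a \<union> b" "a \<subseteq> x - y" "card a + card (x \<inter> y) = t"
          "b \<subseteq> S - x - y" "card b + (card (y - x) + t) = j" by auto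
      have w: "w \<subseteq> S" "y \<subseteq> w" using ab assms by auto
      have e: "x \<inter> w - y = a" "w - x - y = b" using ab by auto
      show "w \<in> ?W"
        using split[OF w] ab(3,5) w unfolding e by simp
    qed
    show "\<forall>w\<in>?W. (\<lambda>(a, b). y \<union> a \<union> b) (x \<inter> w - y, w - x - y) = w" by auto
    show "\<forall>p\<in>?A \<times> ?B. (\<lambda>w. (x \<inter> w - y, w - x - y)) ((\<lambda>(a, b). y \<union> a \<union> b) p) = p"
    proof
      fix p assume "p \<in> ?A \<times> ?B"
      then obtain a b where ab: "p = (a, b)" "a \<subseteq> x - y" "b \<subseteq> S - x - y" by auto
      then show "(\<lambda>w. (x \<inter> w - y, w - x - y)) ((\<lambda>(a, b). y \<union> a \<union> b) p) = p" by auto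
    qed
  qed
  from bij_betw_same_card[OF this] show ?thesis
    by (simp only: card_cartesian_product)
qed

text \<open>Number of j-sets that contain an r-set y and meet an i-set x in t points, where q = |x
  \<inter> y|: choose t - q further points in x - y and fill up outside x \<union> y. The case
  distinctions guard against truncated subtraction.\<close>

definition sup_count :: "nat \<Rightarrow> nat \<Rightarrow> nat \<Rightarrow> nat \<Rightarrow> nat \<Rightarrow> nat \<Rightarrow> nat" where
  "sup_count D t i j r q = (if q \<le> t then (i - q) choose (t - q) else 0) *
     (if (r - q) + t \<le> j then (2*D + 1 - i - (r - q)) choose (j - ((r - q) + t)) else 0)"

text \<open>Vertices represent only the sets of size at most D, so j \<le> D is what makes the count
  over vertices agree with the count over all subsets.\<close>

lemma card_verts_supersets_meeting:
  assumes "x \<in> fc_verts D" "y \<in> fc_verts D" "j \<le> D"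
  shows "card {w \<in> fc_verts D. card (part1 w) = j \<and> card (part1 x \<inter> part1 w) = t \<and> part1 y \<subseteq> part1 w}
    = sup_count D t (card (part1 x)) j (card (part1 y)) (card (part1 x \<inter> part1 y))"
proof -
  note p = part1_props[OF assms(1)] part1_props[OF assms(2)]
  let ?x = "part1 x" and ?y = "part1 y" and ?S = "fc_ground D"
  have yx: "card (?y - ?x) = card ?y - card (?x \<inter> ?y)"
    using card_Diff_subset_Int[of "part1 y" "part1 x"] p by (simp add: Int_commute)
  have xy: "card (?x - ?y) = card ?x - card (?x \<inter> ?y)"
    by (simp add: card_Diff_subset_Int p(3))
  have "?S - ?x - ?y = ?S - ?x - (?y - ?x)" by blast
  moreover have "card (?S - ?x - (?y - ?x)) = card (?S - ?x) - card (?y - ?x)"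
    using p by (intro card_Diff_subset) auto
  moreover have "card (?S - ?x) = 2 * D + 1 - card ?x"
    using p by (simp add: card_Diff_subset)
  ultimately have sxy: "card (?S - ?x - ?y) = 2 * D + 1 - card ?x - (card ?y - card (?x \<inter> ?y))"
    using yx by simp
  have "card {w \<in> fc_verts D. card (part1 w) = j \<and> card (?x \<inter> part1 w) = t \<and> ?y \<subseteq> part1 w}
    = card {w \<in> fc_verts D. part1 w \<subseteq> ?S \<and> card (part1 w) = j \<and> card (?x \<inter> part1 w) = t \<and> ?y \<subseteq> part1 w}"
    using part1_props(1) by (intro arg_cong[where f = card]) blast
  also have "\<dots> = card {w. w \<subseteq> ?S \<and> card w = j \<and> card (?x \<inter> w) = t \<and> ?y \<subseteq> w}"
    using assms(3) by (intro card_fc_verts_part1) auto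
  also have "\<dots> = sup_count D t (card ?x) j (card ?y) (card (?x \<inter> ?y))"
    unfolding sup_count_def using p
    by (simp add: card_supersets_meeting card_subsets_offset xy yx sxy)
  finally show ?thesis .
qed

text \<open>A facet is y without one point a. Deleting a point of x lowers the intersection by one,
  deleting any other point keeps it; so one counts the points of y outside x in the first case and
  inside x in the second.\<close>

lemma card_facets_meeting:
  assumes "finite y" "card y = Suc r"
  shows "card {z. z \<subseteq> y \<and> card z = r \<and> card (x \<inter> z) = q} =
    (if card (x \<inter> y) = q then Suc r - q else if card (x \<inter> y) = Suc q then Suc q else 0)"
proof -
  let ?P = "{a \<in> y. card (x \<inter> (y - {a})) = q}"
  have "bij_betw (\<lambda>a. y - {a}) ?P {z. z \<subseteq> y \<and> card z = r \<and> card (x \<inter> z) = q}"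
    unfolding bij_betw_def
  proof (intro conjI equalityI subsetI)
    show "inj_on (\<lambda>a. y - {a}) ?P" by (rule inj_onI) blast
    fix z assume z: "z \<in> {z. z \<subseteq> y \<and> card z = r \<and> card (x \<inter> z) = q}"
    then have "card (y - z) = 1"
      using assms finite_subset[of z y] by (auto simp: card_Diff_subset)
    then obtain a where "y - z = {a}" by (auto simp: card_1_singleton_iff)
    then have "z = y - {a}" "a \<in> y" using z by auto
    then show "z \<in> (\<lambda>a. y - {a}) ` ?P" using z by auto
  next
    fix z assume "z \<in> (\<lambda>a. y - {a}) ` ?P"
    then obtain a where "a \<in> y" "z = y - {a}" "card (x \<inter> z) = q" by blast
    then show "z \<in> {z. z \<subseteq> y \<and> card z = r \<and> card (x \<inter> z) = q}"
      using assms by (auto simp: card_Diff_singleton)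
  qed
  then have "card {z. z \<subseteq> y \<and> card z = r \<and> card (x \<inter> z) = q} = card ?P"
    by (rule bij_betw_same_card[symmetric])
  also have "?P = {a \<in> y. (a \<in> x \<and> card (x \<inter> y) = Suc q) \<or> (a \<notin> x \<and> card (x \<inter> y) = q)}"
  proof (intro Collect_cong conj_cong refl)
    fix a assume "a \<in> y"
    show "card (x \<inter> (y - {a})) = q \<longleftrightarrow> a \<in> x \<and> card (x \<inter> y) = Suc q \<or> a \<notin> x \<and> card (x \<inter> y) = q"
    proof (cases "a \<in> x")
      case True
      then have "x \<inter> y = insert a (x \<inter> (y - {a}))" using \<open>a \<in> y\<close> by auto
      then have "card (x \<inter> y) = Suc (card (x \<inter> (y - {a})))"
        using assms(1) card_insert_disjoint[of "x \<inter> (y - {a})" a] by simp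
      then show ?thesis using True by simp
    next
      case False
      then have "x \<inter> (y - {a}) = x \<inter> y" by auto
      then show ?thesis using False by simp
    qed
  qed
  also have "card \<dots> = (if card (x \<inter> y) = q then Suc r - q else if card (x \<inter> y) = Suc q then Suc q else 0)"
  proof -
    have "{a \<in> y. a \<notin> x} = y - x" "{a \<in> y. a \<in> x} = x \<inter> y" by auto
    moreover have "card (y - x) = Suc r - card (x \<inter> y)"
      using assms card_Diff_subset_Int[of y x] by (simp add: Int_commute)
    ultimately show ?thesis by auto
  qed
  finally show ?thesis .
qed

text \<open>The left side is the r-th forward difference of n \<mapsto> (n choose (k + r)) at n = m,
  and by Pascal's rule each difference lowers the bottom index by one. In the induction, Pascal's
  rule is applied once to the coefficients, to split off one difference, and once to the values, to
  evaluate it.\<close>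

lemma alternating_binomial_sum:
  "(\<Sum>q\<le>r. (-1) ^ (r - q) * of_nat (r choose q) * of_nat ((m + q) choose (k + r)))
    = (of_nat (m choose k) :: 'a :: comm_ring_1)"
proof (induction r arbitrary: m k)
  case 0
  show ?case by simp
next
  case (Suc r)
  let ?f = "\<lambda>q. of_nat ((m + q) choose (k + Suc r)) :: 'a"
  have "(\<Sum>q\<le>Suc r. (-1) ^ (Suc r - q) * of_nat (Suc r choose q) * ?f q)
    = (-1) ^ Suc r * ?f 0 + (\<Sum>q\<le>r. (-1) ^ (r - q) * of_nat (Suc r choose Suc q) * ?f (Suc q))"
    by (subst sum.atMost_Suc_shift) simp
  also have "\<dots> = (-1) ^ Suc r * ?f 0
      + (\<Sum>q\<le>r. (-1) ^ (r - q) * of_nat (r choose Suc q) * ?f (Suc q))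
      + (\<Sum>q\<le>r. (-1) ^ (r - q) * of_nat (r choose q) * ?f (Suc q))"
    by (simp add: algebra_simps sum.distrib)
  also have "(-1) ^ Suc r * ?f 0 + (\<Sum>q\<le>r. (-1) ^ (r - q) * of_nat (r choose Suc q) * ?f (Suc q))
    = (\<Sum>q\<le>Suc r. (-1) ^ (Suc r - q) * of_nat (r choose q) * ?f q)"
    by (subst sum.atMost_Suc_shift) simp
  also have "\<dots> = - (\<Sum>q\<le>r. (-1) ^ (r - q) * of_nat (r choose q) * ?f q)"
    by (simp add: Suc_diff_le sum_negf binomial_eq_0 del: binomial_Suc_Suc)
  also have "- (\<Sum>q\<le>r. (-1) ^ (r - q) * of_nat (r choose q) * ?f q)
      + (\<Sum>q\<le>r. (-1) ^ (r - q) * of_nat (r choose q) * ?f (Suc q))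
    = (\<Sum>q\<le>r. (-1) ^ (r - q) * of_nat (r choose q) * of_nat ((m + q) choose (k + r)))"
    by (simp add: algebra_simps sum.distrib)
  finally show ?case using Suc.IH by simp
qed

section \<open>Linear algebra\<close>

lemma mat_vec_mult: "mat_vec J (mat_mult K P Q) v = mat_vec K P (mat_vec J Q v)"
  unfolding mat_vec_def mat_mult_def
  by (rule ext) (simp add: sum_distrib_left sum_distrib_right mult.assoc, rule sum.swap)

lemma mat_vec_smult: "mat_vec J P (\<lambda>x. c * v x) = (\<lambda>x. c * mat_vec J P v x)"
  unfolding mat_vec_def by (rule ext) (simp add: sum_distrib_left mult.left_commute)

lemma mat_vec_sum: "mat_vec J P (\<lambda>x. \<Sum>k\<in>K. f k x) = (\<lambda>x. \<Sum>k\<in>K. mat_vec J P (f k) x)"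
  unfolding mat_vec_def by (rule ext) (simp add: sum_distrib_left, rule sum.swap)

lemma sum_fun_apply: "(\<Sum>k\<in>K. f k) x = (\<Sum>k\<in>K. (f k x :: 'a :: comm_monoid_add))"
  by (induction K rule: infinite_finite_induct) auto

lemma inner_vec_smult_left: "inner_vec I (\<lambda>x. c * v x) w = c * inner_vec I v w"
  by (simp add: inner_vec_def sum_distrib_left mult.assoc)

lemma inner_vec_smult_right: "inner_vec I v (\<lambda>x. c * w x) = cnj c * inner_vec I v w"
  by (simp add: inner_vec_def sum_distrib_left mult_ac)

lemma inner_vec_add_right: "inner_vec I v (\<lambda>x. w x + w' x) = inner_vec I v w + inner_vec I v w'"
  by (simp add: inner_vec_def distrib_left sum.distrib)

lemma inner_vec_sum_left: "inner_vec I (\<lambda>x. \<Sum>k\<in>K. f k x) w = (\<Sum>k\<in>K. inner_vec I (f k) w)"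
  unfolding inner_vec_def by (simp add: sum_distrib_right, rule sum.swap)

lemma inner_vec_cnj: "cnj (inner_vec I v w) = inner_vec I w v"
  by (simp add: inner_vec_def mult.commute)

lemma inner_vec_zero [simp]: "inner_vec I (\<lambda>x. 0) w = 0" "inner_vec I v (\<lambda>x. 0) = 0"
  by (simp_all add: inner_vec_def)

lemma inner_vec_self_eq_0:
  assumes "finite I" "v \<in> vecs I" "inner_vec I v v = 0"
  shows "v = (\<lambda>x. 0)"
proof -
  have "inner_vec I v v = of_real (\<Sum>i\<in>I. (cmod (v i))\<^sup>2)"
    unfolding inner_vec_def of_real_sum by (simp only: complex_norm_square)
  then have "(\<Sum>i\<in>I. (cmod (v i))\<^sup>2) = 0" using assms(3) by (metis of_real_eq_0_iff)
  then have "\<forall>i\<in>I. v i = 0" using assms(1) by (simp add: sum_nonneg_eq_0_iff)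
  then show ?thesis using assms(2) unfolding vecs_def by blast
qed

section \<open>Orthonormal families and completeness\<close>

lemma orthonormal_independent:
  assumes "\<forall>a\<in>K. \<forall>b\<in>K. inner_vec I (v a) (v b) = (if a = b then 1 else 0)"
  shows "inj_on v K" "cvec.independent (v ` K)"
proof -
  show inj: "inj_on v K"
    by (rule inj_onI) (metis assms zero_neq_one)
  show "cvec.independent (v ` K)"
    unfolding cvec.independent_explicit_finite_subsets
  proof (intro allI impI ballI)
    fix A c w assume A: "A \<subseteq> v ` K" "finite A" and "(\<Sum>w\<in>A. (\<lambda>i. c w * w i)) = 0" and w: "w \<in> A"
    then have z: "(\<Sum>w\<in>A. c w * w i) = 0" for i
      by (metis (no_types, lifting) sum_fun_apply zero_fun_def sum.cong)
    have "0 = inner_vec I (\<lambda>i. \<Sum>w\<in>A. c w * w i) w" by (simp add: z)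
    also have "\<dots> = (\<Sum>w'\<in>A. c w' * inner_vec I w' w)"
      by (simp add: inner_vec_sum_left inner_vec_smult_left)
    also have "\<dots> = (\<Sum>w'\<in>A. if w' = w then c w' else 0)"
    proof (rule sum.cong[OF refl])
      fix w' assume "w' \<in> A"
      then obtain a b where "a \<in> K" "b \<in> K" "w = v a" "w' = v b" using A w by blast
      then show "c w' * inner_vec I w' w = (if w' = w then c w' else 0)"
        using assms inj_onD[OF inj, of a b] by auto
    qed
    also have "\<dots> = c w" using A w by simp
    finally show "c w = 0" by simp
  qed
qed

lemma vecs_subset_span:
  assumes "finite I"
  shows "vecs I \<subseteq> cvec.span ((\<lambda>i j. if j = i then 1 else 0) ` I)"
proof
  fix v assume v: "v \<in> vecs I"
  have "v = (\<Sum>i\<in>I. (\<lambda>j. v i * (if j = i then 1 else 0)))"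
  proof
    fix j
    have "(\<Sum>i\<in>I. (\<lambda>j. v i * (if j = i then 1 else 0))) j = (\<Sum>i\<in>I. if j = i then v i else 0)"
      unfolding sum_fun_apply by (intro sum.cong) auto
    then show "v j = (\<Sum>i\<in>I. (\<lambda>j. v i * (if j = i then 1 else 0))) j"
      using assms v by (simp add: vecs_def)
  qed
  also have "\<dots> \<in> cvec.span ((\<lambda>i j. if j = i then 1 else 0) ` I)"
    by (intro cvec.span_sum cvec.span_scale cvec.span_base imageI)
  finally show "v \<in> cvec.span ((\<lambda>i j. if j = i then 1 else 0) ` I)" .
qed

lemma vecs_subspace: "cvec.subspace (vecs I)"
  by (rule cvec.subspaceI) (auto simp: vecs_def)

text \<open>Independence bounds the family by the number of unit vectors. Finiteness has to be
  derived, since a sum over an infinite index set is 0 by convention and the projection in the next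
  lemma would be lost.\<close>

lemma orthonormal_finite:
  assumes "finite I" "\<forall>a\<in>K. v a \<in> vecs I"
    and "\<forall>a\<in>K. \<forall>b\<in>K. inner_vec I (v a) (v b) = (if a = b then 1 else 0)"
  shows "finite K"
proof -
  have "finite (v ` K)"
    using cvec.independent_span_bound[OF _ orthonormal_independent(2)[OF assms(3)]]
      vecs_subset_span[OF assms(1)] assms(1,2)
    by (meson finite_imageI image_subsetI subset_trans)
  then show ?thesis using finite_imageD orthonormal_independent(1)[OF assms(3)] by blast
qed

text \<open>The difference between w and its projection onto the family is orthogonal to every
  member, hence zero. Spanning thus reduces to a trivial orthogonal complement.\<close>

lemma orthonormal_basis_vecsI:
  assumes "finite I" and v: "\<And>a. a \<in> K \<Longrightarrow> v a \<in> vecs I"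
    and on: "\<And>a b. a \<in> K \<Longrightarrow> b \<in> K \<Longrightarrow> inner_vec I (v a) (v b) = (if a = b then 1 else 0)"
    and complete: "\<And>w. w \<in> vecs I \<Longrightarrow> (\<And>a. a \<in> K \<Longrightarrow> inner_vec I w (v a) = 0) \<Longrightarrow> w = (\<lambda>x. 0)"
  shows "orthonormal_basis I (vecs I) K v"
proof -
  have fin: "finite K" using orthonormal_finite[of I K v] assms by blast
  have "vecs I \<subseteq> cvec.span (v ` K)"
  proof
    fix w assume w: "w \<in> vecs I"
    let ?p = "\<lambda>i. \<Sum>a\<in>K. inner_vec I w (v a) * v a i"
    have "(\<lambda>i. w i - ?p i) = (\<lambda>i. 0)"
    proof (rule complete)
      show "(\<lambda>i. w i - ?p i) \<in> vecs I"
        using w v unfolding vecs_def by (auto intro!: sum.neutral)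
      fix b assume b: "b \<in> K"
      have "inner_vec I (\<lambda>i. w i - ?p i) (v b) = inner_vec I w (v b) - inner_vec I ?p (v b)"
        by (simp add: inner_vec_def algebra_simps sum_subtractf)
      also have "inner_vec I ?p (v b) = (\<Sum>a\<in>K. if a = b then inner_vec I w (v a) else 0)"
        using b by (simp add: inner_vec_sum_left inner_vec_smult_left on if_distrib cong: if_cong)
      finally show "inner_vec I (\<lambda>i. w i - ?p i) (v b) = 0" using b fin by simp
    qed
    then have "w = (\<Sum>a\<in>K. (\<lambda>i. inner_vec I w (v a) * v a i))"
      by (auto simp: fun_eq_iff sum_fun_apply)
    also have "\<dots> \<in> cvec.span (v ` K)"
      by (intro cvec.span_sum cvec.span_scale cvec.span_base imageI)
    finally show "w \<in> cvec.span (v ` K)" .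
  qed
  moreover have "cvec.span (v ` K) \<subseteq> vecs I"
    using v by (intro cvec.span_minimal vecs_subspace) blast
  ultimately show ?thesis using v on unfolding orthonormal_basis_def by blast
qed

section \<open>The action of the matrices $M^t_{i,j}$ on $\mathcal{L}'_r$\<close>

text \<open>For \<xi> in L'_r this is the value of M^q_{i,r} \<xi> at a vertex x of level i. The
  level of y need not be fixed in the sum because \<xi> vanishes off level r, and i does not occur,
  so that the recursion below is for a single x.\<close>

definition meet_sum :: "nat \<Rightarrow> (fc_vertex \<Rightarrow> complex) \<Rightarrow> fc_vertex \<Rightarrow> nat \<Rightarrow> complex" where
  "meet_sum D \<xi> x q = (\<Sum>y | y \<in> fc_verts D \<and> card (part1 x \<inter> part1 y) = q. \<xi> y)"

lemma fc_L_support: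
  assumes "\<xi> \<in> fc_L D r" "\<xi> y \<noteq> 0"
  shows "y \<in> fc_verts D" "card (part1 y) = r"
  using assms unfolding fc_L_def vecs_def by auto

lemma mat_vec_fc_M:
  assumes "\<xi> \<in> fc_L D r"
  shows "mat_vec (fc_verts D) (fc_M D q i r) \<xi> x =
    (if x \<in> fc_verts D \<and> card (part1 x) = i then meet_sum D \<xi> x q else 0)"
proof (cases "x \<in> fc_verts D \<and> card (part1 x) = i")
  case True
  have "mat_vec (fc_verts D) (fc_M D q i r) \<xi> x
    = (\<Sum>y\<in>fc_verts D. if card (part1 x \<inter> part1 y) = q then \<xi> y else 0)"
    unfolding mat_vec_def
  proof (rule sum.cong[OF refl])
    fix y assume "y \<in> fc_verts D"
    show "fc_M D q i r x y * \<xi> y = (if card (part1 x \<inter> part1 y) = q then \<xi> y else 0)"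
    proof (cases "\<xi> y = 0")
      case False
      then show ?thesis using fc_L_support[OF assms False] True by (simp add: fc_M_def)
    qed simp
  qed
  also have "\<dots> = meet_sum D \<xi> x q"
    unfolding meet_sum_def by (simp add: sum.inter_filter)
  finally show ?thesis using True by simp
next
  case False
  then show ?thesis by (auto simp: mat_vec_def fc_M_def)
qed

text \<open>The defining relation of L'_{r+1} is summed over all r-sets z that meet x in q points.
  Each y is then counted once for every such facet of it: r+1-q times if |x \<inter> y| = q, q+1
  times if |x \<inter> y| = q+1, and never otherwise.\<close>

lemma meet_sum_step:
  assumes \<xi>: "\<xi> \<in> fc_L D (Suc r)" and x: "x \<in> fc_verts D"
  shows "of_nat (Suc r - q) * meet_sum D \<xi> x q + of_nat (Suc q) * meet_sum D \<xi> x (Suc q) = 0"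
proof -
  let ?X = "fc_verts D"
  let ?Z = "{z \<in> ?X. card (part1 z) = r \<and> card (part1 x \<inter> part1 z) = q}"
  have "mat_vec ?X (fc_M D r r (Suc r)) \<xi> = (\<lambda>x. 0)"
    using \<xi> unfolding fc_L_def by auto
  then have "0 = (\<Sum>z\<in>?Z. \<Sum>y\<in>?X. fc_M D r r (Suc r) z y * \<xi> y)"
    by (simp add: mat_vec_def fun_eq_iff)
  also have "\<dots> = (\<Sum>y\<in>?X. \<Sum>z\<in>?Z. fc_M D r r (Suc r) z y * \<xi> y)"
    by (rule sum.swap)
  also have "\<dots> = (\<Sum>y\<in>?X. (if card (part1 x \<inter> part1 y) = q then of_nat (Suc r - q) * \<xi> y else 0)
      + (if card (part1 x \<inter> part1 y) = Suc q then of_nat (Suc q) * \<xi> y else 0))"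
  proof (rule sum.cong[OF refl])
    fix y assume y: "y \<in> ?X"
    show "(\<Sum>z\<in>?Z. fc_M D r r (Suc r) z y * \<xi> y) =
      (if card (part1 x \<inter> part1 y) = q then of_nat (Suc r - q) * \<xi> y else 0)
      + (if card (part1 x \<inter> part1 y) = Suc q then of_nat (Suc q) * \<xi> y else 0)"
    proof (cases "\<xi> y = 0")
      case False
      then have cy: "card (part1 y) = Suc r" using fc_L_support[OF \<xi>] by blast
      let ?W = "{z \<in> ?X. part1 z \<subseteq> part1 y \<and> card (part1 z) = r \<and> card (part1 x \<inter> part1 z) = q}"
      note py = part1_props[OF y]
      have M: "fc_M D r r (Suc r) z y = (if part1 z \<subseteq> part1 y then 1 else 0)" if "z \<in> ?Z" for z
      proof -
        have z: "z \<in> ?X" "card (part1 z) = r" using that by auto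
        have "card (part1 z \<inter> part1 y) = r \<longleftrightarrow> part1 z \<subseteq> part1 y"
          using z part1_props(3)[OF z(1)]
          by (metis Int_lower1 card_subset_eq inf.absorb1 inf.orderI)
        then show ?thesis using z y cy by (simp add: fc_M_def)
      qed
      have "(\<Sum>z\<in>?Z. fc_M D r r (Suc r) z y * \<xi> y) = (\<Sum>z\<in>?Z. if part1 z \<subseteq> part1 y then \<xi> y else 0)"
        using M by (intro sum.cong) auto
      also have "\<dots> = (\<Sum>z\<in>{z \<in> ?Z. part1 z \<subseteq> part1 y}. \<xi> y)"
        by (rule sum.inter_filter[symmetric]) simp
      also have "{z \<in> ?Z. part1 z \<subseteq> part1 y} = ?W" by auto
      also have "(\<Sum>z\<in>?W. \<xi> y) = of_nat (card ?W) * \<xi> y" by simp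
      also have "card ?W = card {z. z \<subseteq> part1 y \<and> card z = r \<and> card (part1 x \<inter> z) = q}"
        using py cy by (intro card_fc_verts_part1) auto
      also have "\<dots> = (if card (part1 x \<inter> part1 y) = q then Suc r - q
          else if card (part1 x \<inter> part1 y) = Suc q then Suc q else 0)"
        by (rule card_facets_meeting[OF py(3) cy])
      finally show ?thesis by auto
    qed simp
  qed
  also have "\<dots> = of_nat (Suc r - q) * meet_sum D \<xi> x q + of_nat (Suc q) * meet_sum D \<xi> x (Suc q)"
    unfolding meet_sum_def sum.distrib sum_distrib_left by (simp add: sum.inter_filter del: of_nat_Suc)
  finally show ?thesis by simp
qed

text \<open>The recursion of \<open>meet_sum_step\<close> is solved downwards from q = r. The
  absorption identities for binomials match the coefficients, and r - q may be cancelled because q <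
  r in the step.\<close>

lemma meet_sum_eq:
  assumes \<xi>: "\<xi> \<in> fc_L D r" and x: "x \<in> fc_verts D" and "q \<le> r"
  shows "meet_sum D \<xi> x q = (-1) ^ (r - q) * of_nat (r choose q) * meet_sum D \<xi> x r"
  using \<open>q \<le> r\<close>
proof (induction rule: inc_induct)
  case (step q)
  then obtain r' where r': "r = Suc r'" by (cases r) auto
  have "of_nat (r - q) * meet_sum D \<xi> x q = - (of_nat (Suc q) * meet_sum D \<xi> x (Suc q))"
    using meet_sum_step[of \<xi> D r' x q] \<xi> x r' by (simp add: eq_neg_iff_add_eq_0)
  also have "\<dots> = (-1) ^ (r - q) * of_nat (Suc q * (r choose Suc q)) * meet_sum D \<xi> x r"
    using step by (simp add: Suc_diff_Suc[symmetric] algebra_simps del: binomial_Suc_Suc)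
  also have "Suc q * (r choose Suc q) = (r - q) * (r choose q)"
    using binomial_absorption[of q r] binomial_absorb_comp[of r q] by simp
  finally have "of_nat (r - q) * meet_sum D \<xi> x q =
    of_nat (r - q) * ((-1) ^ (r - q) * of_nat (r choose q) * meet_sum D \<xi> x r)" by (simp add: mult.assoc)
  then show ?case using step(2) by (simp add: mult.assoc del: of_nat_diff)
qed simp

text \<open>In M^t_{i,j} M^r_{j,r} the entry at (x, y) with |x \<inter> y| = q is a
  \<open>sup_count\<close>; the signed binomial is the price, by \<open>meet_sum_eq\<close>, of
  replacing the sum of \<xi> over those y by its sum over the y contained in x.\<close>

definition fc_coef :: "nat \<Rightarrow> nat \<Rightarrow> nat \<Rightarrow> nat \<Rightarrow> nat \<Rightarrow> complex" where
  "fc_coef D t i j r = (\<Sum>q\<le>r. (-1) ^ (r - q) * of_nat (r choose q) * of_nat (sup_count D t i j r q))"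

text \<open>For fixed x and y the intermediate w are the supersets of y of size j that meet x in t
  points, and their number depends on y only through |x \<inter> y|. Grouping the y by that number
  leaves a combination of the values of \<open>meet_sum\<close>, all of which are multiples of the
  one at q = r.\<close>

lemma fc_M_mult_vec:
  assumes \<xi>: "\<xi> \<in> fc_L D r" and "j \<le> D"
  shows "mat_vec (fc_verts D) (fc_M D t i j) (mat_vec (fc_verts D) (fc_M D r j r) \<xi>)
    = (\<lambda>x. fc_coef D t i j r * mat_vec (fc_verts D) (fc_M D r i r) \<xi> x)"
proof
  fix x
  let ?X = "fc_verts D"
  show "mat_vec ?X (fc_M D t i j) (mat_vec ?X (fc_M D r j r) \<xi>) x
    = fc_coef D t i j r * mat_vec ?X (fc_M D r i r) \<xi> x"
  proof (cases "x \<in> ?X \<and> card (part1 x) = i")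
    case True
    then have x: "x \<in> ?X" "card (part1 x) = i" by auto
    have "mat_vec ?X (fc_M D t i j) (mat_vec ?X (fc_M D r j r) \<xi>) x
      = (\<Sum>w\<in>?X. \<Sum>y\<in>?X. fc_M D t i j x w * fc_M D r j r w y * \<xi> y)"
      by (simp add: mat_vec_def sum_distrib_left mult.assoc)
    also have "\<dots> = (\<Sum>y\<in>?X. \<Sum>w\<in>?X. fc_M D t i j x w * fc_M D r j r w y * \<xi> y)"
      by (rule sum.swap)
    also have "\<dots> = (\<Sum>y\<in>?X. of_nat (sup_count D t i j r (card (part1 x \<inter> part1 y))) * \<xi> y)"
    proof (rule sum.cong[OF refl])
      fix y assume y: "y \<in> ?X"
      show "(\<Sum>w\<in>?X. fc_M D t i j x w * fc_M D r j r w y * \<xi> y)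
        = of_nat (sup_count D t i j r (card (part1 x \<inter> part1 y))) * \<xi> y"
      proof (cases "\<xi> y = 0")
        case False
        then have cy: "card (part1 y) = r" using fc_L_support[OF \<xi>] by blast
        let ?P = "\<lambda>w. card (part1 w) = j \<and> card (part1 x \<inter> part1 w) = t \<and> part1 y \<subseteq> part1 w"
        have "fc_M D t i j x w * fc_M D r j r w y * \<xi> y = (if ?P w then \<xi> y else 0)"
          if w: "w \<in> ?X" for w
        proof -
          have "card (part1 w \<inter> part1 y) = r \<longleftrightarrow> part1 y \<subseteq> part1 w"
            using cy part1_props(3)[OF y]
            by (metis Int_lower2 card_subset_eq inf.absorb2 inf.absorb_iff2)
          then show ?thesis using w x y cy by (simp add: fc_M_def)
        qed
        then have "(\<Sum>w\<in>?X. fc_M D t i j x w * fc_M D r j r w y * \<xi> y)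
          = (\<Sum>w\<in>?X. if ?P w then \<xi> y else 0)" by (rule sum.cong[OF refl])
        also have "\<dots> = (\<Sum>w\<in>{w \<in> ?X. ?P w}. \<xi> y)"
          by (rule sum.inter_filter[symmetric]) simp
        also have "\<dots> = of_nat (card {w \<in> ?X. ?P w}) * \<xi> y" by simp
        finally show ?thesis
          using card_verts_supersets_meeting[OF x(1) y \<open>j \<le> D\<close>, of t] x cy by simp
      qed simp
    qed
    \<comment> \<open>Where \<xi> does not vanish, y has r elements, so q \<le> r covers all
      intersection sizes that matter.\<close>
    also have "\<dots> = (\<Sum>y\<in>?X. \<Sum>q\<le>r. if card (part1 x \<inter> part1 y) = q
        then of_nat (sup_count D t i j r q) * \<xi> y else 0)"
    proof (rule sum.cong[OF refl])
      fix y assume y: "y \<in> ?X"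
      show "of_nat (sup_count D t i j r (card (part1 x \<inter> part1 y))) * \<xi> y =
        (\<Sum>q\<le>r. if card (part1 x \<inter> part1 y) = q then of_nat (sup_count D t i j r q) * \<xi> y else 0)"
      proof (cases "\<xi> y = 0")
        case False
        then have "card (part1 y) = r" using fc_L_support[OF \<xi>] by blast
        then have "card (part1 x \<inter> part1 y) \<le> r"
          using part1_props(3)[OF y] card_mono[of "part1 y" "part1 x \<inter> part1 y"] by simp
        then show ?thesis by simp
      qed simp
    qed
    also have "\<dots> = (\<Sum>q\<le>r. of_nat (sup_count D t i j r q) * meet_sum D \<xi> x q)"
    proof (subst sum.swap, rule sum.cong[OF refl])
      fix q
      have "(\<Sum>y\<in>?X. if card (part1 x \<inter> part1 y) = q then of_nat (sup_count D t i j r q) * \<xi> y else 0)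
        = (\<Sum>y\<in>{y \<in> ?X. card (part1 x \<inter> part1 y) = q}. of_nat (sup_count D t i j r q) * \<xi> y)"
        by (rule sum.inter_filter[symmetric]) simp
      then show "(\<Sum>y\<in>?X. if card (part1 x \<inter> part1 y) = q then of_nat (sup_count D t i j r q) * \<xi> y else 0)
        = of_nat (sup_count D t i j r q) * meet_sum D \<xi> x q"
        by (simp only: meet_sum_def sum_distrib_left)
    qed
    also have "\<dots> = fc_coef D t i j r * meet_sum D \<xi> x r"
      unfolding fc_coef_def sum_distrib_right
    proof (rule sum.cong[OF refl])
      fix q assume "q \<in> {..r}"
      then have "meet_sum D \<xi> x q = (-1) ^ (r - q) * of_nat (r choose q) * meet_sum D \<xi> x r"
        by (intro meet_sum_eq[OF \<xi> x(1)]) simp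
      then show "of_nat (sup_count D t i j r q) * meet_sum D \<xi> x q =
        (-1) ^ (r - q) * of_nat (r choose q) * of_nat (sup_count D t i j r q) * meet_sum D \<xi> x r"
        by (simp only: mult_ac)
    qed
    finally show ?thesis using x by (simp add: mat_vec_fc_M[OF \<xi>])
  next
    case False
    then have "fc_M D t i j x = (\<lambda>y. 0)" by (auto simp: fc_M_def)
    then have "mat_vec ?X (fc_M D t i j) (mat_vec ?X (fc_M D r j r) \<xi>) x = 0"
      unfolding mat_vec_def[of _ "fc_M D t i j"] by simp
    moreover have "mat_vec ?X (fc_M D r i r) \<xi> x = 0"
      unfolding mat_vec_fc_M[OF \<xi>] using False by (rule if_not_P)
    ultimately show ?thesis by simp
  qed
qed

text \<open>With t = i = r the first factor of \<open>sup_count\<close> is 1, and the second has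
  lower index j - 2r + q, which moves with q. Reflecting that binomial gives the constant lower
  index 2D+1-j, the shape required by \<open>alternating_binomial_sum\<close>; a second reflection
  yields j - r.\<close>

lemma fc_coef_level:
  assumes "r \<le> j" "j \<le> D"
  shows "fc_coef D r r j r = of_nat ((2*D + 1 - 2*r) choose (j - r))"
proof -
  have "sup_count D r r j r q = (2*D + 1 - 2*r + q) choose ((2*D + 1 - j - r) + r)" if "q \<le> r" for q
  proof (cases "(r - q) + r \<le> j")
    case True
    then have "2*D + 1 - r - (r - q) = 2*D + 1 - 2*r + q"
      "2*D + 1 - 2*r + q - (j - ((r - q) + r)) = (2*D + 1 - j - r) + r"
      "j - ((r - q) + r) \<le> 2*D + 1 - 2*r + q"
      using assms that by auto
    then show ?thesis using True that binomial_symmetric[of "j - ((r - q) + r)" "2*D + 1 - 2*r + q"]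
      by (simp only: sup_count_def) simp
  next
    case False
    then have "2*D + 1 - 2*r + q < (2*D + 1 - j - r) + r" using assms that by auto
    then show ?thesis using False by (simp add: sup_count_def binomial_eq_0)
  qed
  then have "fc_coef D r r j r = (\<Sum>q\<le>r. (-1) ^ (r - q) * of_nat (r choose q) *
      of_nat ((2*D + 1 - 2*r + q) choose ((2*D + 1 - j - r) + r)))"
    unfolding fc_coef_def by (intro sum.cong) auto
  also have "\<dots> = of_nat ((2*D + 1 - 2*r) choose (2*D + 1 - j - r))"
    by (rule alternating_binomial_sum)
  also have "(2*D + 1 - 2*r) choose (2*D + 1 - j - r) = (2*D + 1 - 2*r) choose (j - r)"
    using assms binomial_symmetric[of "j - r" "2*D + 1 - 2*r"] by (simp add: add.commute)
  finally show ?thesis .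
qed

section \<open>Orthogonality and completeness\<close>

lemma inner_vec_fc_M:
  "inner_vec (fc_verts D) (mat_vec (fc_verts D) (fc_M D t i j) v) w
    = inner_vec (fc_verts D) v (mat_vec (fc_verts D) (fc_M D t j i) w)"
proof -
  have "fc_M D t i j x y = cnj (fc_M D t j i y x)" for x y
    by (auto simp: fc_M_def Int_commute)
  then have "(\<Sum>x\<in>fc_verts D. \<Sum>y\<in>fc_verts D. fc_M D t i j x y * v y * cnj (w x))
    = (\<Sum>x\<in>fc_verts D. \<Sum>y\<in>fc_verts D. v y * (cnj (fc_M D t j i y x) * cnj (w x)))"
    by (simp only: mult_ac)
  also have "\<dots> = (\<Sum>y\<in>fc_verts D. \<Sum>x\<in>fc_verts D. v y * (cnj (fc_M D t j i y x) * cnj (w x)))"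
    by (rule sum.swap)
  finally show ?thesis
    by (simp add: inner_vec_def mat_vec_def sum_distrib_left sum_distrib_right)
qed

text \<open>This is \<open>fc_u\<close> before normalisation, which keeps the square roots out of
  the counting. It also makes sense for i < r, where the binomial in \<open>fc_u\<close> would
  not.\<close>

definition fc_v :: "nat \<Rightarrow> nat \<Rightarrow> (fc_vertex \<Rightarrow> complex) \<Rightarrow> nat \<Rightarrow> fc_vertex \<Rightarrow> complex" where
  "fc_v D r \<xi> i = mat_vec (fc_verts D) (fc_M D r i r) \<xi>"

lemma fc_v_eq_0: "x \<notin> fc_verts D \<or> card (part1 x) \<noteq> i \<Longrightarrow> fc_v D r \<xi> i x = 0"
  by (auto simp: fc_v_def mat_vec_def fc_M_def)

lemma fc_M_fc_v:
  assumes "\<xi> \<in> fc_L D r" "j \<le> D"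
  shows "mat_vec (fc_verts D) (fc_M D t i j) (fc_v D r \<xi> j) = (\<lambda>x. fc_coef D t i j r * fc_v D r \<xi> i x)"
  using fc_M_mult_vec[OF assms] by (simp add: fc_v_def)

text \<open>A set with i < r points contains no r-set. This vanishing is the source both of the
  orthogonality between different r and of the triangular shape behind the matrix units.\<close>

lemma fc_v_below:
  assumes "\<xi> \<in> fc_L D r" "i < r"
  shows "fc_v D r \<xi> i = (\<lambda>x. 0)"
proof
  fix x
  have "meet_sum D \<xi> x r = 0" if "x \<in> fc_verts D" "card (part1 x) = i"
  proof -
    have "card (part1 x \<inter> part1 y) \<le> i" for y
      using that part1_props(3)[OF that(1)] by (metis Int_lower1 card_mono)
    then have "{y \<in> fc_verts D. card (part1 x \<inter> part1 y) = r} = {}"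
      using assms(2) by (metis (mono_tags, lifting) empty_Collect_eq not_le)
    then show ?thesis unfolding meet_sum_def by (simp only: sum.empty)
  qed
  then show "fc_v D r \<xi> i x = 0" by (simp add: fc_v_def mat_vec_fc_M[OF assms(1)])
qed

text \<open>Two r-sets that meet in r points are equal, so M^r_{r,r} is the identity on level
  r.\<close>

lemma fc_v_self:
  assumes "\<xi> \<in> fc_L D r"
  shows "fc_v D r \<xi> r = \<xi>"
proof
  fix x
  show "fc_v D r \<xi> r x = \<xi> x"
  proof (cases "x \<in> fc_verts D \<and> card (part1 x) = r")
    case True
    have "\<xi> y = 0" if "y \<in> {y \<in> fc_verts D. card (part1 x \<inter> part1 y) = r} - {x}" for y
    proof (rule ccontr)
      assume "\<xi> y \<noteq> 0"
      note y = fc_L_support[OF assms this]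
      then have "part1 x = part1 y"
        using that True part1_props(3)
        by (metis (mono_tags, lifting) Diff_iff Int_lower1 Int_lower2 card_subset_eq mem_Collect_eq)
      then show False using that True part1_eq_iff by blast
    qed
    then have "meet_sum D \<xi> x r = (\<Sum>y\<in>{x}. \<xi> y)"
      unfolding meet_sum_def using True by (intro sum.mono_neutral_right) auto
    then show ?thesis using True by (simp add: fc_v_def mat_vec_fc_M[OF assms])
  next
    case False
    then show ?thesis using fc_L_support[OF assms] fc_v_eq_0 by metis
  qed
qed

text \<open>Different levels have disjoint supports. On a common level, the matrix M^a_{i,a} of one
  vector is moved to the other side, where it lowers the other vector to level a. If a is the
  smaller of the two indices, the result is zero by \<open>fc_v_below\<close>; for equal indices the
  factor is the binomial of \<open>fc_coef_level\<close>.\<close>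

lemma inner_fc_v:
  assumes \<xi>: "\<xi> \<in> fc_L D r" and \<eta>: "\<eta> \<in> fc_L D s" and le: "r \<le> i" "s \<le> j" "i \<le> D" "j \<le> D"
  shows "inner_vec (fc_verts D) (fc_v D r \<xi> i) (fc_v D s \<eta> j) =
    (if r = s \<and> i = j then of_nat ((2*D + 1 - 2*r) choose (i - r)) * inner_vec (fc_verts D) \<xi> \<eta> else 0)"
proof (cases "i = j")
  case False
  then have "fc_v D r \<xi> i x * cnj (fc_v D s \<eta> j x) = 0" for x
    using fc_v_eq_0 by (metis complex_cnj_zero_iff mult_eq_0_iff)
  then have "inner_vec (fc_verts D) (fc_v D r \<xi> i) (fc_v D s \<eta> j) = 0"
    unfolding inner_vec_def by (intro sum.neutral ballI)
  then show ?thesis using False by simp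
next
  case True
  have lower: "inner_vec (fc_verts D) (fc_v D a \<alpha> i) (fc_v D b \<beta> i)
      = cnj (fc_coef D a a i b) * inner_vec (fc_verts D) \<alpha> (fc_v D b \<beta> a)"
    if "\<alpha> \<in> fc_L D a" "\<beta> \<in> fc_L D b" for a b \<alpha> \<beta>
    using fc_M_fc_v[OF that(2) le(3)]
    by (simp add: fc_v_def[of D a] inner_vec_fc_M inner_vec_smult_right)
  consider "r = s" | "r < s" | "s < r" by linarith
  then show ?thesis
  proof cases
    case 1
    then show ?thesis using True lower[OF \<xi> \<eta>] \<eta> le by (simp add: fc_v_self fc_coef_level)
  next
    case 2
    then show ?thesis using True lower[OF \<xi> \<eta>] by (simp add: fc_v_below[OF \<eta>])
  next
    case 3
    then have "inner_vec (fc_verts D) (fc_v D s \<eta> i) (fc_v D r \<xi> i) = 0"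
      using lower[OF \<eta> \<xi>] by (simp add: fc_v_below[OF \<xi>])
    then show ?thesis using True 3 inner_vec_cnj[of "fc_verts D" "fc_v D s \<eta> i" "fc_v D r \<xi> i"] by simp
  qed
qed

lemma fc_u_fc_v: "fc_u D r \<xi> i =
    (\<lambda>x. of_real (1 / sqrt (real ((2*D + 1 - 2*r) choose (i - r)))) * fc_v D r \<xi> i x)"
  by (simp add: fc_u_def fc_v_def)

lemma fc_u_smult: "fc_u D r (\<lambda>x. c * \<xi> x) i = (\<lambda>x. c * fc_u D r \<xi> i x)"
  by (simp add: fc_u_def mat_vec_smult mult.left_commute)

lemma fc_u_add: "fc_u D r (\<xi> + \<eta>) i = (\<lambda>x. fc_u D r \<xi> i x + fc_u D r \<eta> i x)"
  by (rule ext) (simp add: fc_u_def mat_vec_def distrib_left sum.distrib add_divide_distrib)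

lemma inner_fc_u:
  assumes \<xi>: "\<xi> \<in> fc_L D r" and \<eta>: "\<eta> \<in> fc_L D s" and le: "r \<le> i" "s \<le> j" "i \<le> D" "j \<le> D"
  shows "inner_vec (fc_verts D) (fc_u D r \<xi> i) (fc_u D s \<eta> j) =
    (if r = s \<and> i = j then inner_vec (fc_verts D) \<xi> \<eta> else 0)"
proof (cases "r = s \<and> i = j")
  case True
  let ?c = "real ((2*D + 1 - 2*r) choose (i - r))"
  have "?c > 0" using le by simp
  then have "complex_of_real (1 / sqrt ?c * (1 / sqrt ?c) * ?c) = 1"
    by (subst of_real_eq_1_iff) simp
  then have c: "complex_of_real (1 / sqrt ?c) * complex_of_real (1 / sqrt ?c) * of_nat ((2*D + 1 - 2*r) choose (i - r)) = 1"
    by (simp only: of_real_mult of_real_of_nat_eq)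
  have "inner_vec (fc_verts D) (fc_u D r \<xi> i) (fc_u D s \<eta> j) =
    complex_of_real (1 / sqrt ?c) * complex_of_real (1 / sqrt ?c) * of_nat ((2*D + 1 - 2*r) choose (i - r))
      * inner_vec (fc_verts D) \<xi> \<eta>"
    using True inner_fc_v[OF assms]
    by (simp only: fc_u_fc_v inner_vec_smult_left inner_vec_smult_right complex_cnj_complex_of_real
        simp_thms if_True mult.assoc)
  then have "inner_vec (fc_verts D) (fc_u D r \<xi> i) (fc_u D s \<eta> j) = inner_vec (fc_verts D) \<xi> \<eta>"
    by (simp only: c mult_1_left)
  then show ?thesis using True by (simp only: simp_thms if_True)
next
  case False
  then show ?thesis
    using inner_fc_v[OF assms]
    by (simp only: fc_u_fc_v inner_vec_smult_left inner_vec_smult_right if_False mult_zero_right)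
qed

lemma level_orthogonal_zero:
  assumes "w \<in> vecs (fc_verts D)" "\<And>x. card (part1 x) \<noteq> i \<Longrightarrow> w x = 0" "i \<le> D"
    and "\<And>r \<xi>. r \<le> i \<Longrightarrow> \<xi> \<in> fc_L D r \<Longrightarrow> inner_vec (fc_verts D) w (fc_v D r \<xi> i) = 0"
  shows "w = (\<lambda>x. 0)"
  using assms
proof (induction i arbitrary: w)
  case 0
  then have "w \<in> fc_L D 0" by (auto simp: fc_L_def)
  then show ?case using 0 inner_vec_self_eq_0[of "fc_verts D" w] by (metis finite_fc_verts fc_v_self le_refl)
next
  case (Suc i)
  let ?w = "mat_vec (fc_verts D) (fc_M D i i (Suc i)) w"
  have "?w = (\<lambda>x. 0)"
  proof (rule Suc.IH)
    show "?w \<in> vecs (fc_verts D)" by (auto simp: vecs_def mat_vec_def fc_M_def)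
    show "?w x = 0" if "card (part1 x) \<noteq> i" for x
      using that by (auto simp: mat_vec_def fc_M_def)
    show "i \<le> D" using Suc.prems by simp
    fix r \<xi> assume r: "r \<le> i" "\<xi> \<in> fc_L D r"
    \<comment> \<open>Moving the lowering matrix to the other side raises \<open>fc_v\<close> from
      level i to level i+1 up to a factor, and w is orthogonal to the raised vector.\<close>
    show "inner_vec (fc_verts D) ?w (fc_v D r \<xi> i) = 0"
      using r Suc.prems by (simp add: inner_vec_fc_M fc_M_fc_v inner_vec_smult_right)
  qed
  \<comment> \<open>Now w is itself one of the vectors to which it is orthogonal, by
    \<open>fc_v_self\<close>.\<close>
  then have "w \<in> fc_L D (Suc i)" using Suc.prems(1,2) by (auto simp: fc_L_def)
  then show ?case
    using Suc.prems inner_vec_self_eq_0[of "fc_verts D" w] by (metis finite_fc_verts fc_v_self le_refl)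
qed

lemma orthogonal_zero:
  assumes w: "w \<in> vecs (fc_verts D)"
    and orth: "\<And>r \<xi> i. \<xi> \<in> fc_L D r \<Longrightarrow> r \<le> i \<Longrightarrow> i \<le> D \<Longrightarrow> inner_vec (fc_verts D) w (fc_v D r \<xi> i) = 0"
  shows "w = (\<lambda>x. 0)"
proof
  fix x
  show "w x = 0"
  proof (cases "x \<in> fc_verts D")
    case True
    let ?i = "card (part1 x)"
    let ?w = "\<lambda>y. if card (part1 y) = ?i then w y else 0"
    have "?w = (\<lambda>x. 0)"
    proof (rule level_orthogonal_zero)
      fix r \<xi> assume r: "r \<le> ?i" "\<xi> \<in> fc_L D r"
      have "inner_vec (fc_verts D) ?w (fc_v D r \<xi> ?i) = inner_vec (fc_verts D) w (fc_v D r \<xi> ?i)"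
        unfolding inner_vec_def by (intro sum.cong refl) (auto simp: fc_v_eq_0)
      then show "inner_vec (fc_verts D) ?w (fc_v D r \<xi> ?i) = 0"
        using orth[OF r(2) r(1)] part1_props(2)[OF True] by simp
    qed (use w part1_props(2)[OF True] in \<open>auto simp: vecs_def\<close>)
    then show ?thesis by (metis (full_types))
  next
    case False
    then show ?thesis using w by (simp add: vecs_def)
  qed
qed

lemma fc_u_orthogonal_zero:
  assumes w: "w \<in> vecs (fc_verts D)"
    and orth: "\<And>r \<xi> i. \<xi> \<in> fc_L D r \<Longrightarrow> r \<le> i \<Longrightarrow> i \<le> D \<Longrightarrow> inner_vec (fc_verts D) w (fc_u D r \<xi> i) = 0"
  shows "w = (\<lambda>x. 0)"
proof (rule orthogonal_zero[OF w])
  fix r \<xi> i assume a: "\<xi> \<in> fc_L D r" "r \<le> i" "i \<le> D"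
  then show "inner_vec (fc_verts D) w (fc_v D r \<xi> i) = 0"
    using orth[OF a] unfolding fc_u_fc_v inner_vec_smult_right by auto
qed

section \<open>Nonzero vectors in $\mathcal{L}'_r$\<close>

text \<open>
  The product of the differences $e_{2k+1} - e_{2k+2}$ for $k < r$. A set of size $r-1$ misses one of the
  pairs, and swapping the two elements of that pair changes the sign of the vector.
\<close>

definition pair_vec :: "nat \<Rightarrow> nat \<Rightarrow> fc_vertex \<Rightarrow> complex" where
  "pair_vec D r x = (if x \<in> fc_verts D \<and> card (part1 x) = r
     then \<Prod>k<r. of_bool (2*k + 1 \<in> part1 x) - of_bool (2*k + 2 \<in> part1 x) else 0)"

text \<open>If every pair were hit, choosing a point of z in each of the r disjoint pairs would give
  r distinct points of z.\<close>

lemma missed_pair: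
  fixes z :: "nat set"
  assumes "finite z" "card z < r"
  obtains k where "k < r" "2*k + 1 \<notin> z" "2*k + 2 \<notin> z"
proof (rule ccontr)
  assume "\<not> thesis"
  with that have hit: "2*k + 1 \<in> z \<or> 2*k + 2 \<in> z" if "k < r" for k using \<open>k < r\<close> by blast
  let ?f = "\<lambda>k. if 2*k + 1 \<in> z then 2*k + 1 else 2*k + 2"
  have "inj_on ?f {..<r}"
  proof (rule inj_onI)
    fix a b assume "?f a = ?f b"
    then show "a = b" by (auto split: if_splits; presburger)
  qed
  moreover have "?f ` {..<r} \<subseteq> z" using hit by auto
  ultimately have "r \<le> card z"
    using assms(1) card_mono[of z "?f ` {..<r}"] card_image[of ?f "{..<r}"] by (simp only: card_lessThan)
  then show False using assms(2) by simp
qed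

lemma pair_vec_fc_L:
  assumes "r \<le> D"
  shows "pair_vec D r \<in> fc_L D r"
proof -
  have "mat_vec (fc_verts D) (fc_M D (r - 1) (r - 1) r) (pair_vec D r) z = 0" if "r \<noteq> 0" for z
  proof (cases "z \<in> fc_verts D \<and> card (part1 z) = r - 1")
    case True
    let ?Y = "{y \<in> fc_verts D. card (part1 y) = r \<and> card (part1 z \<inter> part1 y) = r - 1}"
    have sub: "card (part1 z \<inter> u) = r - 1 \<longleftrightarrow> part1 z \<subseteq> u" for u
      using True part1_props(3)[of z D]
      by (metis Int_lower1 card_subset_eq inf.absorb1 inf.orderI)
    obtain k where k: "k < r" "2*k + 1 \<notin> part1 z" "2*k + 2 \<notin> part1 z"
      using missed_pair[of "part1 z" r] True part1_props(3)[of z D] \<open>r \<noteq> 0\<close> by auto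
    \<comment> \<open>The swap of the two points of the missed pair, and below it the induced
      involution on vertices. Since k < r \<le> D, both points lie in the ground set.\<close>
    let ?s = "transpose (2*k + 1) (2*k + 2)"
    let ?t = "\<lambda>y. {?s ` part1 y, fc_ground D - ?s ` part1 y}"
    have inv: "?s ` ?s ` u = u" for u by (simp add: image_image)
    have mem: "a \<in> ?s ` u \<longleftrightarrow> ?s a \<in> u" for a u
    proof
      assume "?s a \<in> u"
      then show "a \<in> ?s ` u" by (intro image_eqI[where x = "?s a"]) simp_all
    qed auto
    have ground: "?s ` u \<subseteq> fc_ground D" if "u \<subseteq> fc_ground D" for u
    proof
      fix a assume "a \<in> ?s ` u"
      then have "?s a \<in> fc_ground D" using that mem by blast
      then show "a \<in> fc_ground D"
        using k(1) assms by (cases "a = 2*k + 1 \<or> a = 2*k + 2") (auto simp: fc_ground_def)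
    qed
    have t: "?t y \<in> fc_verts D" "part1 (?t y) = ?s ` part1 y" if "y \<in> fc_verts D" for y
      using fc_verts_intro[of "?s ` part1 y" D] ground[of "part1 y"] part1_props[OF that]
      by (simp_all add: card_image)
    have tt: "?t (?t y) = y" if "y \<in> fc_verts D" for y
      using t[OF t(1)[OF that]] t(2)[OF that] inv[of "part1 y"] part1_eq_iff[OF _ that] by metis
    have Y: "?t y \<in> ?Y" if "y \<in> ?Y" for y
    proof -
      have y: "y \<in> fc_verts D" "card (part1 y) = r" "part1 z \<subseteq> part1 y" using that sub by auto
      have "part1 z \<subseteq> ?s ` part1 y"
      proof
        fix a assume "a \<in> part1 z"
        then have "?s a = a" using k by (metis transpose_apply_other)
        then show "a \<in> ?s ` part1 y" using mem y(3) \<open>a \<in> part1 z\<close> by auto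
      qed
      then show ?thesis using t[OF y(1)] y(2) sub by (simp add: card_image)
    qed
    have neg: "pair_vec D r (?t y) = - pair_vec D r y" if "y \<in> ?Y" for y
    proof -
      have y: "y \<in> fc_verts D" "card (part1 y) = r" using that by auto
      let ?g = "\<lambda>u l. of_bool (2*l + 1 \<in> u) - of_bool (2*l + 2 \<in> u) :: complex"
      have "?g (?s ` part1 y) l = ?g (part1 y) l" if "l \<noteq> k" for l
      proof -
        have "?s (2*l + 1) = 2*l + 1" "?s (2*l + 2) = 2*l + 2"
          using that by (intro transpose_apply_other; presburger)+
        then show ?thesis by (simp only: mem)
      qed
      moreover have "?g (?s ` part1 y) k = - ?g (part1 y) k"
        by (simp only: mem transpose_apply_first transpose_apply_second) simp
      moreover have "(\<Prod>l<r. h l) = h k * (\<Prod>l\<in>{..<r} - {k}. h l)" for h :: "nat \<Rightarrow> complex"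
        using k(1) by (intro prod.remove) auto
      ultimately have "(\<Prod>l<r. ?g (?s ` part1 y) l) = - (\<Prod>l<r. ?g (part1 y) l)"
        by (simp cong: prod.cong_simp)
      then show ?thesis
        unfolding pair_vec_def t(2)[OF y(1)] using y t(1)[OF y(1)] by (simp add: card_image)
    qed
    \<comment> \<open>The involution permutes the r-sets above z, because z avoids both swapped
      points, and it negates exactly the factor of index k. The sum therefore equals its own
      negative.\<close>
    have "(\<Sum>y\<in>?Y. pair_vec D r y) = (\<Sum>y\<in>?Y. - pair_vec D r y)"
    proof (rule sum.reindex_bij_witness[where i = ?t and j = ?t])
      fix y assume y: "y \<in> ?Y"
      then show "?t (?t y) = y" "?t (?t y) = y" using tt by blast+
      show "?t y \<in> ?Y" "?t y \<in> ?Y" using Y[OF y] by blast+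
      show "- pair_vec D r (?t y) = pair_vec D r y" using neg[OF y] by simp
    qed
    then have "(\<Sum>y\<in>?Y. pair_vec D r y) = 0" by (simp add: sum_negf)
    moreover have "mat_vec (fc_verts D) (fc_M D (r - 1) (r - 1) r) (pair_vec D r) z
      = (\<Sum>y\<in>fc_verts D. if card (part1 y) = r \<and> card (part1 z \<inter> part1 y) = r - 1
          then pair_vec D r y else 0)"
      unfolding mat_vec_def using True by (intro sum.cong) (auto simp: fc_M_def)
    ultimately show ?thesis by (simp add: sum.inter_filter)
  next
    case False
    then show ?thesis by (auto simp: mat_vec_def fc_M_def)
  qed
  then show ?thesis by (auto simp: fc_L_def vecs_def pair_vec_def)
qed

lemma pair_vec_nonzero:
  assumes "r \<le> D"
  shows "pair_vec D r \<noteq> (\<lambda>x. 0)"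
proof -
  \<comment> \<open>The set of first points of the r pairs, at which every factor equals 1.\<close>
  let ?u = "(\<lambda>k. 2*k + 1) ` {..<r}"
  have c: "card ?u = r" by (simp add: card_image inj_on_def)
  have "?u \<subseteq> fc_ground D" using assms by (auto simp: fc_ground_def)
  note v = fc_verts_intro[OF this, unfolded c, OF assms]
  have "2*k + 1 \<in> ?u" if "k < r" for k using that by auto
  moreover have "2*k + 2 \<notin> ?u" for k by auto presburger
  ultimately have "(\<Prod>k<r. of_bool (2*k + 1 \<in> ?u) - of_bool (2*k + 2 \<in> ?u) :: complex) = 1"
    by (intro prod.neutral ballI) (simp only: of_bool_eq lessThan_iff, simp)
  then have "pair_vec D r {?u, fc_ground D - ?u} = 1"
    unfolding pair_vec_def v(2) using v(1) c by simp
  then show ?thesis by (metis zero_neq_one)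
qed

section \<open>Block actions\<close>

text \<open>The matrix \<beta> r may not depend on \<xi>; this is what makes all blocks of index r
  equal. Quantifying over the whole of L'_r keeps the notion independent of a choice of basis. Only
  the entries with both indices in N_r are constrained.\<close>

definition block_action ::
  "nat \<Rightarrow> (fc_vertex \<Rightarrow> fc_vertex \<Rightarrow> complex) \<Rightarrow> (nat \<Rightarrow> nat \<Rightarrow> nat \<Rightarrow> complex) \<Rightarrow> bool" where
  "block_action D M \<beta> \<longleftrightarrow> (\<forall>r\<le>D. \<forall>\<xi>\<in>fc_L D r. \<forall>j\<in>fc_N D r.
     mat_vec (fc_verts D) M (fc_u D r \<xi> j) = (\<lambda>x. \<Sum>i\<in>fc_N D r. \<beta> r i j * fc_u D r \<xi> i x))"

lemma block_action_cong:
  assumes "block_action D M \<beta>"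
    and "\<And>r i j. r \<le> D \<Longrightarrow> i \<in> fc_N D r \<Longrightarrow> j \<in> fc_N D r \<Longrightarrow> \<beta> r i j = \<gamma> r i j"
  shows "block_action D M \<gamma>"
  using assms unfolding block_action_def by (auto intro!: sum.cong)

lemma block_action_sum:
  assumes "\<And>k. k \<in> K \<Longrightarrow> block_action D (M k) (\<beta> k)"
  shows "block_action D (\<lambda>x y. \<Sum>k\<in>K. c k * M k x y) (\<lambda>r i j. \<Sum>k\<in>K. c k * \<beta> k r i j)"
  unfolding block_action_def
proof (intro allI impI ballI ext)
  fix r \<xi> j x assume a: "r \<le> D" "\<xi> \<in> fc_L D r" "j \<in> fc_N D r"
  have "mat_vec (fc_verts D) (\<lambda>x y. \<Sum>k\<in>K. c k * M k x y) (fc_u D r \<xi> j) x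
    = (\<Sum>k\<in>K. c k * mat_vec (fc_verts D) (M k) (fc_u D r \<xi> j) x)"
    unfolding mat_vec_def by (simp add: sum_distrib_left sum_distrib_right mult.assoc, rule sum.swap)
  also have "\<dots> = (\<Sum>k\<in>K. c k * (\<Sum>i\<in>fc_N D r. \<beta> k r i j * fc_u D r \<xi> i x))"
    using assms a unfolding block_action_def by (intro sum.cong) auto
  also have "\<dots> = (\<Sum>i\<in>fc_N D r. (\<Sum>k\<in>K. c k * \<beta> k r i j) * fc_u D r \<xi> i x)"
    by (simp add: sum_distrib_left sum_distrib_right mult.assoc, rule sum.swap)
  finally show "mat_vec (fc_verts D) (\<lambda>x y. \<Sum>k\<in>K. c k * M k x y) (fc_u D r \<xi> j) x
    = (\<Sum>i\<in>fc_N D r. (\<Sum>k\<in>K. c k * \<beta> k r i j) * fc_u D r \<xi> i x)" .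
qed

lemma block_action_add:
  assumes "block_action D M \<beta>" "block_action D M' \<beta>'"
  shows "block_action D (\<lambda>x y. M x y + M' x y) (\<lambda>r i j. \<beta> r i j + \<beta>' r i j)"
  using block_action_sum[of UNIV D "\<lambda>b. if b then M else M'" "\<lambda>b. if b then \<beta> else \<beta>'" "\<lambda>_. 1"] assms
  by (simp add: UNIV_bool add.commute)

lemma block_action_smult:
  assumes "block_action D M \<beta>"
  shows "block_action D (\<lambda>x y. c * M x y) (\<lambda>r i j. c * \<beta> r i j)"
  using block_action_sum[of "{()}" D "\<lambda>_. M" "\<lambda>_. \<beta>" "\<lambda>_. c"] assms by simp

lemma block_action_mult:
  assumes "block_action D M \<beta>" "block_action D M' \<beta>'"
  shows "block_action D (mat_mult (fc_verts D) M M') (\<lambda>r i j. \<Sum>k\<in>fc_N D r. \<beta> r i k * \<beta>' r k j)"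
  unfolding block_action_def
proof (intro allI impI ballI ext)
  fix r \<xi> j x assume a: "r \<le> D" "\<xi> \<in> fc_L D r" "j \<in> fc_N D r"
  have "mat_vec (fc_verts D) (mat_mult (fc_verts D) M M') (fc_u D r \<xi> j) x
    = (\<Sum>k\<in>fc_N D r. \<beta>' r k j * mat_vec (fc_verts D) M (fc_u D r \<xi> k) x)"
    using assms(2) a unfolding block_action_def by (simp add: mat_vec_mult mat_vec_sum mat_vec_smult)
  also have "\<dots> = (\<Sum>k\<in>fc_N D r. \<beta>' r k j * (\<Sum>i\<in>fc_N D r. \<beta> r i k * fc_u D r \<xi> i x))"
    using assms(1) a unfolding block_action_def by (intro sum.cong) auto
  also have "\<dots> = (\<Sum>k\<in>fc_N D r. \<Sum>i\<in>fc_N D r. \<beta> r i k * \<beta>' r k j * fc_u D r \<xi> i x)"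
    by (simp add: sum_distrib_left mult_ac)
  also have "\<dots> = (\<Sum>i\<in>fc_N D r. (\<Sum>k\<in>fc_N D r. \<beta> r i k * \<beta>' r k j) * fc_u D r \<xi> i x)"
    unfolding sum_distrib_right by (rule sum.swap)
  finally show "mat_vec (fc_verts D) (mat_mult (fc_verts D) M M') (fc_u D r \<xi> j) x
    = (\<Sum>i\<in>fc_N D r. (\<Sum>k\<in>fc_N D r. \<beta> r i k * \<beta>' r k j) * fc_u D r \<xi> i x)" .
qed

lemma block_action_one:
  "block_action D (\<lambda>x y. if x \<in> fc_verts D \<and> x = y then 1 else 0) (\<lambda>r i j. if i = j then 1 else 0)"
  unfolding block_action_def
proof (intro allI impI ballI ext)
  fix r \<xi> j x assume a: "j \<in> fc_N D r"
  let ?X = "fc_verts D"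
  have z: "fc_u D r \<xi> j x = 0" if "x \<notin> ?X" using that by (simp add: fc_u_fc_v fc_v_eq_0)
  have "mat_vec ?X (\<lambda>x y. if x \<in> ?X \<and> x = y then 1 else 0) (fc_u D r \<xi> j) x
    = (\<Sum>y\<in>?X. if y = x then fc_u D r \<xi> j y else 0)"
    unfolding mat_vec_def by (intro sum.cong) auto
  also have "\<dots> = fc_u D r \<xi> j x" using z by simp
  also have "\<dots> = (\<Sum>i\<in>fc_N D r. if i = j then fc_u D r \<xi> i x else 0)"
    using a by (simp add: fc_N_def)
  also have "\<dots> = (\<Sum>i\<in>fc_N D r. (if i = j then 1 else 0) * fc_u D r \<xi> i x)"
    by (intro sum.cong) auto
  finally show "mat_vec ?X (\<lambda>x y. if x \<in> ?X \<and> x = y then 1 else 0) (fc_u D r \<xi> j) x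
    = (\<Sum>i\<in>fc_N D r. (if i = j then 1 else 0) * fc_u D r \<xi> i x)" .
qed

definition fc_norm :: "nat \<Rightarrow> nat \<Rightarrow> nat \<Rightarrow> complex" where
  "fc_norm D r i = complex_of_real (1 / sqrt (real ((2*D + 1 - 2*r) choose (i - r))))"

lemma fc_norm_nonzero: "r \<le> i \<Longrightarrow> i \<le> D \<Longrightarrow> fc_norm D r i \<noteq> 0"
  by (simp add: fc_norm_def)

text \<open>This is \<open>fc_M_mult_vec\<close> rewritten for normalised vectors, which produces
  the quotient of norms. In a block with r > i both sides vanish: \<open>fc_v\<close> is zero on
  level i, and i is not a row index of N_r.\<close>

lemma block_action_fc_M:
  assumes "i \<le> D" "j \<le> D"
  shows "block_action D (fc_M D t i j) (\<lambda>r a b. if a = i \<and> b = j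
    then fc_coef D t i j r * fc_norm D r j / fc_norm D r i else 0)"
  unfolding block_action_def
proof (intro allI impI ballI ext)
  fix r \<xi> b x assume a: "r \<le> D" "\<xi> \<in> fc_L D r" "b \<in> fc_N D r"
  let ?X = "fc_verts D"
  let ?k = "fc_coef D t i j r * fc_norm D r j / fc_norm D r i"
  have u: "fc_u D r \<xi> c = (\<lambda>x. fc_norm D r c * fc_v D r \<xi> c x)" for c
    by (simp add: fc_u_fc_v fc_norm_def)
  have rhs: "(\<Sum>a\<in>fc_N D r. (if a = i \<and> b = j then ?k else 0) * fc_u D r \<xi> a x)
    = (if b = j \<and> i \<in> fc_N D r then ?k * fc_u D r \<xi> i x else 0)"
  proof -
    have "(\<Sum>a\<in>fc_N D r. (if a = i \<and> b = j then ?k else 0) * fc_u D r \<xi> a x)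
      = (\<Sum>a\<in>fc_N D r. if a = i then (if b = j then ?k * fc_u D r \<xi> i x else 0) else 0)"
      by (intro sum.cong) auto
    then show ?thesis by (simp add: fc_N_def)
  qed
  show "mat_vec ?X (fc_M D t i j) (fc_u D r \<xi> b) x
    = (\<Sum>a\<in>fc_N D r. (if a = i \<and> b = j then ?k else 0) * fc_u D r \<xi> a x)"
  proof (cases "b = j")
    case True
    have "mat_vec ?X (fc_M D t i j) (fc_u D r \<xi> b) x = fc_norm D r j * fc_coef D t i j r * fc_v D r \<xi> i x"
      unfolding u mat_vec_smult using True fc_M_fc_v[OF a(2) assms(2)] by simp
    also have "\<dots> = (if i \<in> fc_N D r then ?k * fc_u D r \<xi> i x else 0)"
    proof (cases "r \<le> i")
      case True
      then show ?thesis using fc_norm_nonzero[OF True assms(1)] assms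
        unfolding u by (simp add: fc_N_def)
    next
      case False
      then show ?thesis using fc_v_below[OF a(2), of i] by (simp add: fc_N_def)
    qed
    finally show ?thesis using rhs True by simp
  next
    case False
    have "mat_vec ?X (fc_M D t i j) (fc_u D r \<xi> b) x = 0"
      unfolding mat_vec_def u using False by (intro sum.neutral) (auto simp: fc_M_def fc_v_eq_0)
    then show ?thesis using rhs False by simp
  qed
qed

text \<open>A matrix of this form is the combination of the M^t_{i,j} with coefficients F i j t,
  since each pair of vertices lies in the support of exactly one of them. Both kinds of generators
  of T are covered.\<close>

lemma block_action_invariant:
  "\<exists>\<beta>. block_action D (\<lambda>x y. if x \<in> fc_verts D \<and> y \<in> fc_verts D
     then F (card (part1 x)) (card (part1 y)) (card (part1 x \<inter> part1 y)) else 0) \<beta>"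
proof -
  let ?K = "{..D} \<times> {..D} \<times> {..D}"
  let ?M = "\<lambda>k x y. case k of (i, j, t) \<Rightarrow> fc_M D t i j x y"
  let ?c = "\<lambda>k. case k of (i, j, t) \<Rightarrow> F i j t"
  have "\<forall>k\<in>?K. \<exists>\<beta>. block_action D (?M k) \<beta>" using block_action_fc_M by fastforce
  then obtain \<beta> where "\<And>k. k \<in> ?K \<Longrightarrow> block_action D (?M k) (\<beta> k)" by metis
  then have "block_action D (\<lambda>x y. \<Sum>k\<in>?K. ?c k * ?M k x y) (\<lambda>r i j. \<Sum>k\<in>?K. ?c k * \<beta> k r i j)"
    by (rule block_action_sum)
  moreover have "(\<lambda>x y. \<Sum>k\<in>?K. ?c k * ?M k x y) = (\<lambda>x y. if x \<in> fc_verts D \<and> y \<in> fc_verts D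
     then F (card (part1 x)) (card (part1 y)) (card (part1 x \<inter> part1 y)) else 0)"
  proof (intro ext)
    fix x y
    show "(\<Sum>k\<in>?K. ?c k * ?M k x y) = (if x \<in> fc_verts D \<and> y \<in> fc_verts D
     then F (card (part1 x)) (card (part1 y)) (card (part1 x \<inter> part1 y)) else 0)"
    proof (cases "x \<in> fc_verts D \<and> y \<in> fc_verts D")
      case True
      let ?k = "(card (part1 x), card (part1 y), card (part1 x \<inter> part1 y))"
      have "card (part1 x \<inter> part1 y) \<le> D"
        using True part1_props[of x D] by (meson Int_lower1 card_mono le_trans)
      then have "?k \<in> ?K" using True part1_props(2) by auto
      moreover have "(\<Sum>k\<in>?K. ?c k * ?M k x y) = (\<Sum>k\<in>?K. if k = ?k then ?c k else 0)"
        using True by (intro sum.cong refl) (auto simp: fc_M_def split: if_splits)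
      ultimately show ?thesis using True by simp
    qed (auto simp: fc_M_def intro!: sum.neutral)
  qed
  ultimately show ?thesis by auto
qed

section \<open>The Terwilliger algebra\<close>

lemma terwilliger_closed:
  shows terwilliger_one: "(\<lambda>x y. if x \<in> fc_verts D \<and> x = y then 1 else 0) \<in> terwilliger D"
    and terwilliger_add: "M \<in> terwilliger D \<Longrightarrow> M' \<in> terwilliger D \<Longrightarrow> (\<lambda>x y. M x y + M' x y) \<in> terwilliger D"
    and terwilliger_mult: "M \<in> terwilliger D \<Longrightarrow> M' \<in> terwilliger D \<Longrightarrow> mat_mult (fc_verts D) M M' \<in> terwilliger D"
    and terwilliger_smult: "M \<in> terwilliger D \<Longrightarrow> (\<lambda>x y. c * M x y) \<in> terwilliger D"
  using generated_subalgebra.one[of "mat_alg (fc_verts D)"]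
    generated_subalgebra.add[of M "mat_alg (fc_verts D)" _ M']
    generated_subalgebra.mult[of M "mat_alg (fc_verts D)" _ M']
    generated_subalgebra.smult[of M "mat_alg (fc_verts D)" _ c]
  by (simp_all add: terwilliger_def mat_alg_def)

lemma terwilliger_induct [consumes 1, case_names A Estar one add mult smult]:
  assumes "M \<in> terwilliger D"
    and "\<And>k. k \<le> D \<Longrightarrow> P (fc_A D k)" "\<And>k. k \<le> D \<Longrightarrow> P (fc_Estar D k)"
    and "P (\<lambda>x y. if x \<in> fc_verts D \<and> x = y then 1 else 0)"
    and "\<And>M M'. P M \<Longrightarrow> P M' \<Longrightarrow> P (\<lambda>x y. M x y + M' x y)"
    and "\<And>M M'. P M \<Longrightarrow> P M' \<Longrightarrow> P (mat_mult (fc_verts D) M M')"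
    and "\<And>c M. P M \<Longrightarrow> P (\<lambda>x y. c * M x y)"
  shows "P M"
  using assms(1) unfolding terwilliger_def
proof (induction rule: generated_subalgebra.induct)
  case (gen a)
  then show ?case using assms(2,3) by auto
qed (use assms(4-7) in \<open>simp_all add: mat_alg_def\<close>)

lemma terwilliger_sum:
  "(\<And>k. k \<in> K \<Longrightarrow> M k \<in> terwilliger D) \<Longrightarrow> (\<lambda>x y. \<Sum>k\<in>K. c k * M k x y) \<in> terwilliger D"
proof (induction K rule: infinite_finite_induct)
  case (insert k K)
  then show ?case
    using terwilliger_add[OF terwilliger_smult[of "M k" D "c k"], of "\<lambda>x y. \<Sum>k\<in>K. c k * M k x y"] by simp
qed (use terwilliger_smult[OF terwilliger_one, of 0 D] in simp_all)

lemma terwilliger_mats: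
  assumes "M \<in> terwilliger D"
  shows "M \<in> mats (fc_verts D) (fc_verts D)"
  using assms
proof (induction rule: terwilliger_induct)
  case (mult M M')
  then show ?case unfolding mats_def mat_mult_def by (auto intro!: sum.neutral)
qed (auto simp: mats_def fc_A_def fc_Estar_def)

text \<open>With i, j, t the sizes of x1, y1 and their intersection, the symmetric difference has i
  + j - 2t points, which determines the entries of A_k, and E*_k has entry 1 exactly when i = j = t
  = k. The remaining cases are closure properties of block actions.\<close>

lemma terwilliger_block_action:
  assumes "M \<in> terwilliger D"
  shows "\<exists>\<beta>. block_action D M \<beta>"
  using assms
proof (induction rule: terwilliger_induct)
  case (A k)
  have "fc_A D k = (\<lambda>x y. if x \<in> fc_verts D \<and> y \<in> fc_verts D
     then (\<lambda>i j t. if min (i + j - 2*t) (2*D + 1 - (i + j - 2*t)) = k then 1 else 0)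
       (card (part1 x)) (card (part1 y)) (card (part1 x \<inter> part1 y)) else 0)"
  proof (intro ext)
    fix x y
    have "card (sym_diff (part1 x) (part1 y)) = card (part1 x) + card (part1 y) - 2 * card (part1 x \<inter> part1 y)"
      if "x \<in> fc_verts D" "y \<in> fc_verts D"
      using card_sym_diff_plus[of "part1 x" "part1 y"] that part1_props(3) by (metis add_diff_cancel_right')
    then show "fc_A D k x y = (if x \<in> fc_verts D \<and> y \<in> fc_verts D
     then (\<lambda>i j t. if min (i + j - 2*t) (2*D + 1 - (i + j - 2*t)) = k then 1 else 0)
       (card (part1 x)) (card (part1 y)) (card (part1 x \<inter> part1 y)) else 0)"
      by (auto simp: fc_A_def fc_dist_eq)
  qed
  then show ?case
    using block_action_invariant[of D "\<lambda>i j t. if min (i + j - 2*t) (2*D + 1 - (i + j - 2*t)) = k then 1 else 0"]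
    by metis
next
  case (Estar k)
  have "fc_Estar D k = (\<lambda>x y. if x \<in> fc_verts D \<and> y \<in> fc_verts D
     then (\<lambda>i j t. if i = k \<and> j = k \<and> t = k then 1 else 0)
       (card (part1 x)) (card (part1 y)) (card (part1 x \<inter> part1 y)) else 0)"
  proof (intro ext)
    fix x y
    have "x = y \<longleftrightarrow> card (part1 x) = card (part1 y) \<and> card (part1 x \<inter> part1 y) = card (part1 y)"
      if v: "x \<in> fc_verts D" "y \<in> fc_verts D"
    proof
      assume a: "card (part1 x) = card (part1 y) \<and> card (part1 x \<inter> part1 y) = card (part1 y)"
      have "part1 x \<inter> part1 y = part1 x" "part1 x \<inter> part1 y = part1 y"
        using a v part1_props(3) by (intro card_subset_eq; auto)+
      then show "x = y" using part1_eq_iff[OF v] by auto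
    qed auto
    then show "fc_Estar D k x y = (if x \<in> fc_verts D \<and> y \<in> fc_verts D
     then (\<lambda>i j t. if i = k \<and> j = k \<and> t = k then 1 else 0)
       (card (part1 x)) (card (part1 y)) (card (part1 x \<inter> part1 y)) else 0)"
      by (auto simp: fc_Estar_def fc_dist_zero)
  qed
  then show ?case
    using block_action_invariant[of D "\<lambda>i j t. if i = k \<and> j = k \<and> t = k then 1 else 0"] by metis
qed (blast intro: block_action_one block_action_add block_action_mult block_action_smult)+

section \<open>Matrices M^t_{i,j} with extreme t as elements of T\<close>

lemma folded_distance_eq_iff:
  fixes m t i j D :: nat
  assumes "m + 2 * t = i + j" "t \<le> i" "t \<le> j" "i \<le> D" "j \<le> D"
  shows "min m (2 * D + 1 - m) = max i j - min i j \<longleftrightarrow> t = min i j"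
proof
  assume a: "min m (2 * D + 1 - m) = max i j - min i j"
  \<comment> \<open>\<open>2 * D + 1\<close> is odd, while \<open>m\<close> and the difference of \<open>i\<close> and \<open>j\<close> have the same parity.\<close>
  have "2 * D + 1 \<noteq> m + (max i j - min i j)"
  proof
    assume odd: "2 * D + 1 = m + (max i j - min i j)"
    obtain d where d: "max i j = min i j + d" by (metis le_iff_add max.cobounded1 min.coboundedI1)
    have "max i j + min i j = i + j" by (simp add: max_def min_def)
    then have "m + 2 * t = 2 * min i j + d" using d assms(1) by simp
    then have "2 * D + 1 + 2 * t = 2 * (min i j + d)" using odd d by simp
    then show False by presburger
  qed
  moreover have "m \<le> 2 * D" using assms by linarith
  ultimately have "m = max i j - min i j" using a by (auto simp: min_def split: if_splits)
  then show "t = min i j" using assms(1) by (auto simp: min_def max_def split: if_splits)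
next
  assume "t = min i j"
  then have "m = max i j - min i j" using assms(1) by (auto simp: min_def max_def split: if_splits)
  moreover have "max i j - min i j \<le> D" using assms by simp
  ultimately show "min m (2 * D + 1 - m) = max i j - min i j"
    using min_absorb1[of m "2 * D + 1 - m"] by linarith
qed

text \<open>The matrix is E*_i A_k E*_j with k = |i-j|: between these levels distance k means, by
  \<open>folded_distance_eq_iff\<close>, that the smaller of x1 and y1 is contained in the
  larger.\<close>

lemma fc_M_terwilliger:
  assumes "i \<le> D" "j \<le> D"
  shows "fc_M D (min i j) i j \<in> terwilliger D"
proof -
  let ?X = "fc_verts D"
  let ?k = "max i j - min i j"
  have gen: "fc_A D k \<in> terwilliger D" "fc_Estar D k \<in> terwilliger D" if "k \<le> D" for k
    using that unfolding terwilliger_def by (auto intro!: generated_subalgebra.gen)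
  have "mat_mult ?X (mat_mult ?X (fc_Estar D i) (fc_A D ?k)) (fc_Estar D j) \<in> terwilliger D"
    using assms by (intro terwilliger_mult gen) auto
  moreover have "mat_mult ?X (mat_mult ?X (fc_Estar D i) (fc_A D ?k)) (fc_Estar D j) = fc_M D (min i j) i j"
  proof (intro ext)
    fix x y
    have left: "mat_mult ?X (fc_Estar D i) (fc_A D ?k) x z
      = (if x \<in> ?X \<and> card (part1 x) = i then fc_A D ?k x z else 0)" for z
    proof -
      have "mat_mult ?X (fc_Estar D i) (fc_A D ?k) x z =
        (\<Sum>w\<in>?X. if w = x then (if card (part1 x) = i then fc_A D ?k x z else 0) else 0)"
        unfolding mat_mult_def by (intro sum.cong) (auto simp: fc_Estar_def fc_dist_zero)
      then show ?thesis by simp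
    qed
    have "mat_mult ?X (mat_mult ?X (fc_Estar D i) (fc_A D ?k)) (fc_Estar D j) x y
      = (\<Sum>w\<in>?X. if w = y then (if card (part1 y) = j \<and> x \<in> ?X \<and> card (part1 x) = i
          then fc_A D ?k x y else 0) else 0)"
      unfolding mat_mult_def[of _ "mat_mult _ _ _"] left
      by (intro sum.cong) (auto simp: fc_Estar_def fc_dist_zero)
    also have "\<dots> = (if y \<in> ?X \<and> card (part1 y) = j \<and> x \<in> ?X \<and> card (part1 x) = i
          then fc_A D ?k x y else 0)" by simp
    also have "\<dots> = fc_M D (min i j) i j x y"
    proof (cases "y \<in> ?X \<and> card (part1 y) = j \<and> x \<in> ?X \<and> card (part1 x) = i")
      case True
      then have v: "x \<in> ?X" "y \<in> ?X" by auto
      have f: "finite (part1 x)" "finite (part1 y)" using part1_props(3) v by auto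
      let ?m = "card (sym_diff (part1 x) (part1 y))" and ?t = "card (part1 x \<inter> part1 y)"
      have "?m + 2 * ?t = i + j" using card_sym_diff_plus[OF f] True by simp
      moreover have "?t \<le> i" "?t \<le> j" using True f by (metis card_mono Int_lower1 Int_lower2)+
      ultimately have "min ?m (2 * D + 1 - ?m) = ?k \<longleftrightarrow> ?t = min i j"
        using assms by (intro folded_distance_eq_iff)
      then show ?thesis using True fc_dist_eq[OF v] by (simp only: fc_A_def fc_M_def simp_thms if_True)
    qed (auto simp: fc_M_def)
    finally show "mat_mult ?X (mat_mult ?X (fc_Estar D i) (fc_A D ?k)) (fc_Estar D j) x y
      = fc_M D (min i j) i j x y" .
  qed
  ultimately show ?thesis by simp
qed

text \<open>An r-set that contains the r-set y is y itself, so only q = r contributes to the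
  alternating sum.\<close>

lemma fc_coef_up: "fc_coef D r i r r = 1"
proof -
  have "fc_coef D r i r r = (\<Sum>q\<le>r. if q = r then 1 else 0)"
    unfolding fc_coef_def by (intro sum.cong) (auto simp: sup_count_def)
  then show ?thesis by simp
qed

lemma matrix_unit_in_terwilliger:
  assumes "r \<le> D" "i \<in> fc_N D r" "j \<in> fc_N D r"
  shows "\<exists>E\<in>terwilliger D. block_action D E (\<lambda>s a b. if s = r \<and> a = i \<and> b = j then 1 else 0)"
  using assms
proof (induction r rule: less_induct)
  case (less r)
  have ij: "r \<le> i" "i \<le> D" "r \<le> j" "j \<le> D" using less.prems by (auto simp: fc_N_def)
  let ?K = "mat_mult (fc_verts D) (fc_M D r i r) (fc_M D r r j)"
  let ?p = "\<lambda>s. fc_coef D r i r s * fc_norm D s r / fc_norm D s i"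
  let ?q = "\<lambda>s. fc_coef D r r j s * fc_norm D s j / fc_norm D s r"
  \<comment> \<open>The only entry of \<open>?K\<close> in block s that can be nonzero, at position
    (i, j). It occurs only for s \<le> r, because the intermediate level r must belong to
    N_s.\<close>
  define \<kappa> where "\<kappa> s = ?p s * ?q s" for s
  have KT: "?K \<in> terwilliger D"
    using fc_M_terwilliger[of i D r] fc_M_terwilliger[of r D j] ij less.prems(1)
    by (intro terwilliger_mult) (simp_all add: min_absorb1 min_absorb2)
  have "block_action D ?K (\<lambda>s a b. \<Sum>c\<in>fc_N D s.
      (if a = i \<and> c = r then ?p s else 0) * (if c = r \<and> b = j then ?q s else 0))"
    using ij less.prems(1) by (intro block_action_mult block_action_fc_M) auto
  moreover have "(\<Sum>c\<in>fc_N D s. (if a = i \<and> c = r then ?p s else 0) * (if c = r \<and> b = j then ?q s else 0))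
    = (if s \<le> r \<and> a = i \<and> b = j then \<kappa> s else 0)" for s a b
  proof -
    have "(\<Sum>c\<in>fc_N D s. (if a = i \<and> c = r then ?p s else 0) * (if c = r \<and> b = j then ?q s else 0))
      = (\<Sum>c\<in>fc_N D s. if c = r then (if a = i \<and> b = j then \<kappa> s else 0) else 0)"
      by (intro sum.cong) (auto simp: \<kappa>_def)
    then show ?thesis using less.prems(1) by (simp add: fc_N_def)
  qed
  ultimately have Kact: "block_action D ?K (\<lambda>s a b. if s \<le> r \<and> a = i \<and> b = j then \<kappa> s else 0)"
    by simp
  \<comment> \<open>In block r the raising factor is 1 and the lowering factor is (2D+1-2r choose
    j-r), which is positive because j \<le> D.\<close>
  have "\<kappa> r \<noteq> 0"
    using ij less.prems(1) fc_norm_nonzero[of r i D] fc_norm_nonzero[of r j D] fc_norm_nonzero[of r r D]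
    by (simp add: \<kappa>_def fc_coef_up fc_coef_level)
  \<comment> \<open>The same i and j are admissible in the earlier blocks, since N_r is contained in
    N_s for s < r.\<close>
  have "\<forall>s\<in>{..<r}. \<exists>E\<in>terwilliger D. block_action D E (\<lambda>s' a b. if s' = s \<and> a = i \<and> b = j then 1 else 0)"
    using less.IH less.prems by (auto simp: fc_N_def)
  then obtain E where E: "\<And>s. s < r \<Longrightarrow> E s \<in> terwilliger D"
    "\<And>s. s < r \<Longrightarrow> block_action D (E s) (\<lambda>s' a b. if s' = s \<and> a = i \<and> b = j then 1 else 0)"
    by (metis lessThan_iff)
  \<comment> \<open>\<open>?K\<close> vanishes on the blocks above \<open>r\<close>; its contributions below \<open>r\<close> are cancelled by the
    units already constructed.\<close>
  define M where "M s = (if s = r then ?K else E s)" for s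
  define \<beta> where "\<beta> s = (\<lambda>s' a b. if s = r then (if s' \<le> r \<and> a = i \<and> b = j then \<kappa> s' else 0)
      else (if s' = s \<and> a = i \<and> b = j then 1 else 0))" for s
  define c where "c s = (if s = r then 1 / \<kappa> r else - \<kappa> s / \<kappa> r)" for s
  have "(\<lambda>x y. \<Sum>s\<le>r. c s * M s x y) \<in> terwilliger D"
    using KT E(1) by (intro terwilliger_sum) (auto simp: M_def)
  moreover have "block_action D (\<lambda>x y. \<Sum>s\<le>r. c s * M s x y) (\<lambda>s' a b. \<Sum>s\<le>r. c s * \<beta> s s' a b)"
    using Kact E(2) by (intro block_action_sum) (auto simp: M_def \<beta>_def)
  moreover have "(\<Sum>s\<le>r. c s * \<beta> s s' a b) = (if s' = r \<and> a = i \<and> b = j then 1 else 0)" for s' a b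
  proof -
    have "(\<Sum>s\<le>r. c s * \<beta> s s' a b) = c r * \<beta> r s' a b + (\<Sum>s<r. c s * \<beta> s s' a b)"
      by (simp add: lessThan_Suc_atMost[symmetric] add.commute)
    also have "(\<Sum>s<r. c s * \<beta> s s' a b) = (\<Sum>s<r. if s = s' then (if a = i \<and> b = j then c s else 0) else 0)"
      by (intro sum.cong) (auto simp: \<beta>_def)
    also have "\<dots> = (if s' < r \<and> a = i \<and> b = j then c s' else 0)" by simp
    finally show ?thesis using \<open>\<kappa> r \<noteq> 0\<close> by (auto simp: c_def \<beta>_def)
  qed
  ultimately show ?case by (intro bexI) auto
qed

section \<open>Reading off the blocks, and the isomorphism\<close>

lemma block_action_entry:
  assumes act: "block_action D M \<beta>" and \<xi>: "\<xi> \<in> fc_L D r" and \<eta>: "\<eta> \<in> fc_L D s"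
    and "r \<le> D" "s \<le> D" "j \<in> fc_N D r" "i \<in> fc_N D s"
  shows "inner_vec (fc_verts D) (mat_vec (fc_verts D) M (fc_u D r \<xi> j)) (fc_u D s \<eta> i) =
    (if r = s then \<beta> r i j * inner_vec (fc_verts D) \<xi> \<eta> else 0)"
proof -
  let ?I = "inner_vec (fc_verts D)"
  have "?I (mat_vec (fc_verts D) M (fc_u D r \<xi> j)) (fc_u D s \<eta> i)
    = ?I (\<lambda>x. \<Sum>k\<in>fc_N D r. \<beta> r k j * fc_u D r \<xi> k x) (fc_u D s \<eta> i)"
    using assms unfolding block_action_def by auto
  also have "\<dots> = (\<Sum>k\<in>fc_N D r. \<beta> r k j * ?I (fc_u D r \<xi> k) (fc_u D s \<eta> i))"
    by (simp add: inner_vec_sum_left inner_vec_smult_left)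
  also have "\<dots> = (\<Sum>k\<in>fc_N D r. if k = i then (if r = s then \<beta> r i j * ?I \<xi> \<eta> else 0) else 0)"
    using assms by (intro sum.cong) (auto simp: fc_N_def inner_fc_u)
  also have "\<dots> = (if r = s then \<beta> r i j * ?I \<xi> \<eta> else 0)"
    using assms by (simp add: fc_N_def)
  finally show ?thesis .
qed

text \<open>Equal block actions force equal images of all the vectors u, so each row of the
  difference, conjugated to match the second slot of \<open>inner_vec\<close>, is orthogonal to all
  of them and vanishes by completeness.\<close>

lemma block_action_inject:
  assumes "M \<in> mats (fc_verts D) (fc_verts D)" "M' \<in> mats (fc_verts D) (fc_verts D)"
    and "block_action D M \<beta>" "block_action D M' \<beta>"
  shows "M = M'"
proof
  fix x
  let ?w = "\<lambda>y. cnj (M x y - M' x y)"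
  have "?w = (\<lambda>y. 0)"
  proof (rule fc_u_orthogonal_zero)
    show "?w \<in> vecs (fc_verts D)" using assms(1,2) by (auto simp: vecs_def mats_def)
    fix r \<xi> i assume a: "\<xi> \<in> fc_L D r" "r \<le> i" "i \<le> D"
    then have "mat_vec (fc_verts D) M (fc_u D r \<xi> i) x = mat_vec (fc_verts D) M' (fc_u D r \<xi> i) x"
      using assms(3,4) unfolding block_action_def fc_N_def by auto
    then have "inner_vec (fc_verts D) (fc_u D r \<xi> i) ?w = 0"
      by (simp add: inner_vec_def mat_vec_def algebra_simps sum_subtractf)
    then show "inner_vec (fc_verts D) ?w (fc_u D r \<xi> i) = 0"
      using inner_vec_cnj[of "fc_verts D" "fc_u D r \<xi> i" ?w] by simp
  qed
  then show "M x = M' x" by (auto simp: fun_eq_iff)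
qed

text \<open>A unit vector in each L'_r serves as a probe: by \<open>block_action_entry\<close> the
  inner products in \<open>h\<close> return the entries of \<beta>, whichever unit vector is taken.
  Hence any \<beta> describing the action may be used to compute \<open>h\<close>, and the
  homomorphism laws become those of block actions.\<close>

lemma terwilliger_alg_iso:
  assumes \<zeta>: "\<And>r. r \<le> D \<Longrightarrow> \<zeta> r \<in> fc_L D r \<and> inner_vec (fc_verts D) (\<zeta> r) (\<zeta> r) = 1"
  shows "alg_isomorphic (terwilliger_alg D) (direct_sum_alg {0..D} (\<lambda>r. mat_alg (fc_N D r)))"
proof -
  let ?X = "fc_verts D" and ?T = "terwilliger_alg D"
  let ?S = "direct_sum_alg {0..D} (\<lambda>r. mat_alg (fc_N D r))"
  \<comment> \<open>Normal form in the direct sum: zero outside N_r \<times> N_r, as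
    \<open>mats\<close> demands, and undefined outside {0..D}, as the extensional product
    demands.\<close>
  define blocks where "blocks \<beta> = (\<lambda>r\<in>{0..D}. \<lambda>i j. if i \<in> fc_N D r \<and> j \<in> fc_N D r then \<beta> r i j else 0)"
    for \<beta> :: "nat \<Rightarrow> nat \<Rightarrow> nat \<Rightarrow> complex"
  define h where "h M = blocks (\<lambda>r i j. inner_vec ?X (mat_vec ?X M (fc_u D r (\<zeta> r) j)) (fc_u D r (\<zeta> r) i))" for M
  have h: "h M = blocks \<beta>" if "block_action D M \<beta>" for M \<beta>
    unfolding h_def blocks_def
  proof (intro restrict_ext ext)
    fix r i j assume "r \<in> {0..D}"
    then show "(if i \<in> fc_N D r \<and> j \<in> fc_N D r
        then inner_vec ?X (mat_vec ?X M (fc_u D r (\<zeta> r) j)) (fc_u D r (\<zeta> r) i) else 0)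
      = (if i \<in> fc_N D r \<and> j \<in> fc_N D r then \<beta> r i j else 0)"
      using block_action_entry[OF that, of "\<zeta> r" r "\<zeta> r" r j i] \<zeta>[of r] by auto
  qed
  have finN: "finite (fc_N D r)" for r by (simp add: fc_N_def)
  have cS: "carrier ?S = (\<Pi>\<^sub>E r\<in>{0..D}. mats (fc_N D r) (fc_N D r))"
    by (simp add: direct_sum_alg_def mat_alg_def)
  have cT: "carrier ?T = terwilliger D" by (simp add: terwilliger_alg_def)
  have blocks_S: "blocks \<beta> \<in> carrier ?S" for \<beta>
    unfolding cS blocks_def by (auto simp: mats_def)
  have "h \<in> ring_hom ?T ?S"
  proof (rule ring_hom_memI)
    fix M assume M: "M \<in> carrier ?T"
    show "h M \<in> carrier ?S" unfolding h_def by (rule blocks_S)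
    fix M' assume M': "M' \<in> carrier ?T"
    obtain \<beta> \<beta>' where \<beta>: "block_action D M \<beta>" "block_action D M' \<beta>'"
      using terwilliger_block_action M M' cT by metis
    have "h (mat_mult ?X M M') = blocks (\<lambda>r i j. \<Sum>k\<in>fc_N D r. \<beta> r i k * \<beta>' r k j)"
      by (rule h[OF block_action_mult[OF \<beta>]])
    also have "\<dots> = blocks \<beta> \<otimes>\<^bsub>?S\<^esub> blocks \<beta>'"
      by (auto simp: direct_sum_alg_def mat_alg_def blocks_def mat_mult_def fun_eq_iff intro!: sum.cong)
    finally show "h (M \<otimes>\<^bsub>?T\<^esub> M') = h M \<otimes>\<^bsub>?S\<^esub> h M'"
      by (simp add: terwilliger_alg_def mat_alg_def h[OF \<beta>(1)] h[OF \<beta>(2)])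
    have "h (\<lambda>x y. M x y + M' x y) = blocks (\<lambda>r i j. \<beta> r i j + \<beta>' r i j)"
      by (rule h[OF block_action_add[OF \<beta>]])
    also have "\<dots> = blocks \<beta> \<oplus>\<^bsub>?S\<^esub> blocks \<beta>'"
      by (auto simp: direct_sum_alg_def mat_alg_def blocks_def fun_eq_iff)
    finally show "h (M \<oplus>\<^bsub>?T\<^esub> M') = h M \<oplus>\<^bsub>?S\<^esub> h M'"
      by (simp add: terwilliger_alg_def mat_alg_def h[OF \<beta>(1)] h[OF \<beta>(2)])
  next
    have "h (\<lambda>x y. if x \<in> ?X \<and> x = y then 1 else 0) = blocks (\<lambda>r i j. if i = j then 1 else 0)"
      by (rule h[OF block_action_one])
    also have "\<dots> = \<one>\<^bsub>?S\<^esub>"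
      by (auto simp: direct_sum_alg_def mat_alg_def blocks_def fun_eq_iff)
    finally show "h \<one>\<^bsub>?T\<^esub> = \<one>\<^bsub>?S\<^esub>"
      by (simp add: terwilliger_alg_def mat_alg_def)
  qed
  moreover have "bij_betw h (carrier ?T) (carrier ?S)"
  proof (rule bij_betw_imageI)
    show "inj_on h (carrier ?T)"
    proof (rule inj_onI)
      fix M M' assume M: "M \<in> carrier ?T" "M' \<in> carrier ?T" and eq: "h M = h M'"
      obtain \<beta> \<beta>' where \<beta>: "block_action D M \<beta>" "block_action D M' \<beta>'"
        using terwilliger_block_action M cT by metis
      have "blocks \<beta> = blocks \<beta>'" using eq h \<beta> by simp
      have "\<beta>' r i j = \<beta> r i j" if "r \<le> D" "i \<in> fc_N D r" "j \<in> fc_N D r" for r i j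
      proof -
        have "blocks \<beta> r i j = blocks \<beta>' r i j" using \<open>blocks \<beta> = blocks \<beta>'\<close> by simp
        then show ?thesis using that by (simp add: blocks_def)
      qed
      then have "block_action D M' \<beta>" by (rule block_action_cong[OF \<beta>(2)])
      then show "M = M'"
        using block_action_inject[OF _ _ \<beta>(1)] terwilliger_mats M cT by blast
    qed
    show "h ` carrier ?T = carrier ?S"
    proof (intro equalityI subsetI)
      fix f assume f: "f \<in> carrier ?S"
      let ?K = "SIGMA r:{0..D}. fc_N D r \<times> fc_N D r"
      let ?\<delta> = "\<lambda>k s a b. if (s, a, b) = k then 1 else 0 :: complex"
      let ?c = "\<lambda>k. f (fst k) (fst (snd k)) (snd (snd k))"
      have "\<forall>k\<in>?K. \<exists>E\<in>terwilliger D. block_action D E (?\<delta> k)"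
      proof
        fix k assume "k \<in> ?K"
        then obtain r i j where "k = (r, i, j)" "r \<le> D" "i \<in> fc_N D r" "j \<in> fc_N D r" by auto
        then show "\<exists>E\<in>terwilliger D. block_action D E (?\<delta> k)"
          using matrix_unit_in_terwilliger[of r D i j] by simp
      qed
      from bchoice[OF this[unfolded Bex_def]]
      obtain E where "\<forall>k\<in>?K. E k \<in> terwilliger D \<and> block_action D (E k) (?\<delta> k)" ..
      then have E: "\<And>k. k \<in> ?K \<Longrightarrow> E k \<in> terwilliger D"
        "\<And>k. k \<in> ?K \<Longrightarrow> block_action D (E k) (?\<delta> k)" by blast+
      \<comment> \<open>The preimage of f combines the matrix units with the entries of f as
        coefficients.\<close>
      let ?M = "\<lambda>x y. \<Sum>k\<in>?K. ?c k * E k x y"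
      have "block_action D ?M (\<lambda>s a b. \<Sum>k\<in>?K. ?c k * ?\<delta> k s a b)"
        using E(2) by (rule block_action_sum)
      then have "block_action D ?M f"
      proof (rule block_action_cong)
        fix r i j assume a: "r \<le> D" "i \<in> fc_N D r" "j \<in> fc_N D r"
        have "(\<Sum>k\<in>?K. ?c k * ?\<delta> k r i j) = (\<Sum>k\<in>?K. if k = (r, i, j) then f r i j else 0)"
          by (intro sum.cong) auto
        also have "\<dots> = f r i j" using a finN by (subst sum.delta) auto
        finally show "(\<Sum>k\<in>?K. ?c k * ?\<delta> k r i j) = f r i j" .
      qed
      then have "h ?M = blocks f" by (rule h)
      also have "\<dots> = f"
      proof
        fix r
        show "blocks f r = f r"
        proof (cases "r \<in> {0..D}")
          case True
          then have "f r \<in> mats (fc_N D r) (fc_N D r)" using f cS by auto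
          then show ?thesis using True by (auto simp: blocks_def mats_def fun_eq_iff)
        next
          case False
          then show ?thesis using f cS by (auto simp: blocks_def PiE_def extensional_def)
        qed
      qed
      finally show "f \<in> h ` carrier ?T"
        using terwilliger_sum[OF E(1), where c = ?c]
        unfolding cT by (rule image_eqI[OF sym])
    qed (auto simp: h_def blocks_S)
  qed
  moreover have "h (c \<odot>\<^bsub>?T\<^esub> M) = c \<odot>\<^bsub>?S\<^esub> h M" if M: "M \<in> carrier ?T" for c M
  proof -
    obtain \<beta> where \<beta>: "block_action D M \<beta>" using terwilliger_block_action M cT by metis
    have "h (\<lambda>x y. c * M x y) = blocks (\<lambda>r i j. c * \<beta> r i j)"
      by (rule h[OF block_action_smult[OF \<beta>]])
    also have "\<dots> = c \<odot>\<^bsub>?S\<^esub> blocks \<beta>"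
      by (auto simp: direct_sum_alg_def mat_alg_def blocks_def fun_eq_iff)
    finally show ?thesis by (simp add: terwilliger_alg_def mat_alg_def h[OF \<beta>])
  qed
  ultimately show ?thesis unfolding alg_isomorphic_def ring_iso_def by blast
qed

theorem theorem4p14:
  fixes D :: nat and B :: "nat \<Rightarrow> (fc_vertex \<Rightarrow> complex) set"
  assumes "D \<ge> 3"
    and "\<And>r. r \<le> D \<Longrightarrow> orthonormal_basis (fc_verts D) (fc_L D r) (B r) (\<lambda>\<xi>. \<xi>)"
    and "\<And>r \<xi> x. r \<le> D \<Longrightarrow> \<xi> \<in> B r \<Longrightarrow> x \<in> fc_verts D \<Longrightarrow> \<xi> x \<in> \<real>"
  shows "orthonormal_basis (fc_verts D) (vecs (fc_verts D)) (fc_index D B) (\<lambda>b x. fc_U D B x b) \<and>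
    (\<forall>M \<in> terwilliger D.
       let W = mat_mult (fc_verts D)
                 (mat_mult (fc_verts D) (mat_transpose (fc_U D B)) M) (fc_U D B)
       in (\<forall>r \<xi> i r' \<xi>' j. (r, \<xi>, i) \<in> fc_index D B \<longrightarrow> (r', \<xi>', j) \<in> fc_index D B \<longrightarrow>
             (r, \<xi>) \<noteq> (r', \<xi>') \<longrightarrow> W (r, \<xi>, i) (r', \<xi>', j) = 0) \<and>
          (\<forall>r \<le> D. \<forall>\<xi> \<in> B r. \<forall>\<xi>' \<in> B r. \<forall>i \<in> fc_N D r. \<forall>j \<in> fc_N D r.
             W (r, \<xi>, i) (r, \<xi>, j) = W (r, \<xi>', i) (r, \<xi>', j))) \<and>
    alg_isomorphic (terwilliger_alg D) (direct_sum_alg {0..D} (\<lambda>r. mat_alg (fc_N D r)))"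
proof (intro conjI)
  let ?X = "fc_verts D" and ?I = "inner_vec (fc_verts D)" and ?J = "fc_index D B"
  have BL: "\<xi> \<in> fc_L D r" if "r \<le> D" "\<xi> \<in> B r" for r \<xi>
    using assms(2) that unfolding orthonormal_basis_def by blast
  have Bon: "?I \<xi> \<eta> = (if \<xi> = \<eta> then 1 else 0)" if "r \<le> D" "\<xi> \<in> B r" "\<eta> \<in> B r" for r \<xi> \<eta>
    using assms(2) that unfolding orthonormal_basis_def by blast
  have Bspan: "cvec.span (B r) = fc_L D r" if "r \<le> D" for r
    using assms(2)[OF that] unfolding orthonormal_basis_def by simp
  have U: "(\<lambda>x. fc_U D B x (r, \<xi>, i)) = fc_u D r \<xi> i" if "(r, \<xi>, i) \<in> ?J" for r \<xi> i
    using that by (simp add: fc_U_def)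
  have J: "r \<le> D" "\<xi> \<in> B r" "\<xi> \<in> fc_L D r" "i \<in> fc_N D r" "r \<le> i" "i \<le> D"
    if "(r, \<xi>, i) \<in> ?J" for r \<xi> i
    using that BL by (auto simp: fc_index_def fc_N_def)

  show "orthonormal_basis ?X (vecs ?X) ?J (\<lambda>b x. fc_U D B x b)"
  proof (rule orthonormal_basis_vecsI)
    fix a assume a: "a \<in> ?J"
    obtain r \<xi> i where ra: "a = (r, \<xi>, i)" by (cases a)
    show "(\<lambda>x. fc_U D B x a) \<in> vecs ?X"
      using U[of r \<xi> i] a ra fc_v_eq_0 by (auto simp: vecs_def fc_u_fc_v)
    fix b assume b: "b \<in> ?J"
    obtain s \<eta> j where sb: "b = (s, \<eta>, j)" by (cases b)
    show "?I (\<lambda>x. fc_U D B x a) (\<lambda>x. fc_U D B x b) = (if a = b then 1 else 0)"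
      using J[OF a[unfolded ra]] J[OF b[unfolded sb]] Bon[of r \<xi> \<eta>]
      by (auto simp: ra sb U[OF a[unfolded ra]] U[OF b[unfolded sb]] inner_fc_u)
  next
    fix w assume w: "w \<in> vecs ?X" and orth: "\<And>a. a \<in> ?J \<Longrightarrow> ?I w (\<lambda>x. fc_U D B x a) = 0"
    show "w = (\<lambda>x. 0)"
    proof (rule fc_u_orthogonal_zero[OF w])
      fix r \<xi> i assume a: "\<xi> \<in> fc_L D r" "r \<le> i" "i \<le> D"
      \<comment> \<open>Orthogonality is given only for members of B r but wanted on all of L'_r.
        The condition is conjugate linear in \<xi>, so it defines a subspace, and this subspace
        contains the span of B r.\<close>
      let ?V = "{\<xi>. ?I w (fc_u D r \<xi> i) = 0}"
      have "cvec.span (B r) \<subseteq> ?V"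
      proof (rule cvec.span_minimal)
        show "B r \<subseteq> ?V"
        proof
          fix \<eta> assume "\<eta> \<in> B r"
          then have "(r, \<eta>, i) \<in> ?J" using a by (simp add: fc_index_def fc_N_def)
          then show "\<eta> \<in> ?V" using orth[of "(r, \<eta>, i)"] U by simp
        qed
        show "cvec.subspace ?V"
        proof (rule cvec.subspaceI)
          show "0 \<in> ?V" using fc_u_smult[of D r 0 0 i] by (simp add: zero_fun_def)
        qed (simp_all add: fc_u_add fc_u_smult inner_vec_smult_right inner_vec_add_right)
      qed
      then show "?I w (fc_u D r \<xi> i) = 0" using a Bspan[of r] by auto
    qed
  qed simp

  show "\<forall>M \<in> terwilliger D.
       let W = mat_mult ?X (mat_mult ?X (mat_transpose (fc_U D B)) M) (fc_U D B)
       in (\<forall>r \<xi> i r' \<xi>' j. (r, \<xi>, i) \<in> ?J \<longrightarrow> (r', \<xi>', j) \<in> ?J \<longrightarrow>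
             (r, \<xi>) \<noteq> (r', \<xi>') \<longrightarrow> W (r, \<xi>, i) (r', \<xi>', j) = 0) \<and>
          (\<forall>r \<le> D. \<forall>\<xi> \<in> B r. \<forall>\<xi>' \<in> B r. \<forall>i \<in> fc_N D r. \<forall>j \<in> fc_N D r.
             W (r, \<xi>, i) (r, \<xi>, j) = W (r, \<xi>', i) (r, \<xi>', j))"
  proof
    fix M assume "M \<in> terwilliger D"
    then obtain \<beta> where \<beta>: "block_action D M \<beta>" using terwilliger_block_action by blast
    let ?W = "mat_mult ?X (mat_mult ?X (mat_transpose (fc_U D B)) M) (fc_U D B)"
    have W: "?W (r, \<xi>, i) (r', \<xi>', j) = (if (r, \<xi>) = (r', \<xi>') then \<beta> r i j else 0)"
      if a: "(r, \<xi>, i) \<in> ?J" and b: "(r', \<xi>', j) \<in> ?J" for r \<xi> i r' \<xi>' j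
    proof -
      \<comment> \<open>The product uses the transpose, whereas \<open>inner_vec\<close> conjugates
        its second argument. Realness of the basis vectors reconciles the two.\<close>
      have real: "cnj (fc_U D B x (r, \<xi>, i)) = fc_U D B x (r, \<xi>, i)" for x
      proof -
        have "cnj (\<xi> y) = \<xi> y" if "y \<in> ?X" for y
          using assms(3) J(1,2)[OF a] that Reals_cnj_iff by blast
        moreover have "cnj (fc_M D r i r x y) = fc_M D r i r x y" for x y by (simp add: fc_M_def)
        ultimately show ?thesis using a by (simp add: fc_U_def fc_u_def mat_vec_def)
      qed
      have "?W (r, \<xi>, i) (r', \<xi>', j)
        = (\<Sum>y\<in>?X. \<Sum>x\<in>?X. fc_U D B x (r, \<xi>, i) * M x y * fc_U D B y (r', \<xi>', j))"
        by (simp add: mat_mult_def mat_transpose_def sum_distrib_right)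
      also have "\<dots> = (\<Sum>x\<in>?X. \<Sum>y\<in>?X. M x y * fc_U D B y (r', \<xi>', j) * cnj (fc_U D B x (r, \<xi>, i)))"
        by (subst sum.swap) (simp only: real mult_ac)
      also have "\<dots> = ?I (mat_vec ?X M (\<lambda>y. fc_U D B y (r', \<xi>', j))) (\<lambda>x. fc_U D B x (r, \<xi>, i))"
        by (simp only: inner_vec_def mat_vec_def sum_distrib_right)
      also have "\<dots> = (if r' = r then \<beta> r' i j * ?I \<xi>' \<xi> else 0)"
        unfolding U[OF a] U[OF b] using J[OF a] J[OF b] by (intro block_action_entry[OF \<beta>])
      also have "\<dots> = (if (r, \<xi>) = (r', \<xi>') then \<beta> r i j else 0)"
        using J[OF a] J[OF b] Bon[of r \<xi>' \<xi>] by auto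
      finally show ?thesis .
    qed
    have "?W (r, \<xi>, i) (r, \<xi>, j) = \<beta> r i j"
      if "r \<le> D" "\<xi> \<in> B r" "i \<in> fc_N D r" "j \<in> fc_N D r" for r \<xi> i j
      using W[of r \<xi> i r \<xi> j] that by (simp add: fc_index_def)
    then show "let W = ?W
       in (\<forall>r \<xi> i r' \<xi>' j. (r, \<xi>, i) \<in> ?J \<longrightarrow> (r', \<xi>', j) \<in> ?J \<longrightarrow>
             (r, \<xi>) \<noteq> (r', \<xi>') \<longrightarrow> W (r, \<xi>, i) (r', \<xi>', j) = 0) \<and>
          (\<forall>r \<le> D. \<forall>\<xi> \<in> B r. \<forall>\<xi>' \<in> B r. \<forall>i \<in> fc_N D r. \<forall>j \<in> fc_N D r.
             W (r, \<xi>, i) (r, \<xi>, j) = W (r, \<xi>', i) (r, \<xi>', j))"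
      using W unfolding Let_def by simp
  qed

  \<comment> \<open>An empty B r would span only the zero space, contradicting the nonzero
    \<open>pair_vec\<close>. Any member of B r is then a unit vector that can probe block r.\<close>
  have "\<exists>\<zeta>. \<zeta> \<in> B r" if "r \<le> D" for r
  proof (rule ccontr)
    assume "\<not> (\<exists>\<zeta>. \<zeta> \<in> B r)"
    then have "B r = {}" by blast
    then have "pair_vec D r \<in> {0}" using Bspan[OF that] pair_vec_fc_L[OF that] by simp
    then show False using pair_vec_nonzero[OF that] by (simp add: zero_fun_def)
  qed
  then obtain \<zeta> where "\<And>r. r \<le> D \<Longrightarrow> \<zeta> r \<in> B r" by metis
  then show "alg_isomorphic (terwilliger_alg D) (direct_sum_alg {0..D} (\<lambda>r. mat_alg (fc_N D r)))"
    using BL Bon by (intro terwilliger_alg_iso[of D \<zeta>]) auto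
qed

end
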